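(* Let $U$, $H=(L_2(\Omega))^m$, $\mathcal D\colon U\to H$, $Y$, and the bilinear forms $\langle\cdot,\cdot\rangle_y$ ($y\in Y$) on $H$ be as in the context, and let $(\Phi_J)_{J\in\mathbb N}$ be a family of frames $\Phi=\Phi_J=\{\varphi_i : i\in\mathcal I\}$ (with finite index set $\mathcal I=\mathcal I_J$) for the subspaces $U_\Phi=\operatorname{span}\Phi\subset U$, with frame constants $c_{\Phi_J},C_{\Phi_J}>0$ satisfying $$\sup_{J\in\mathbb N}\frac{C_{\Phi_J}}{c_{\Phi_J}}<\infty .$$ Assume that there are constants $0<c_U\le C_U<\infty$ such that $$c_U\|u\|_U^2\le\langle\mathcal D u,\mathcal D u\rangle_y\le C_U\|u\|_U^2\qquad\text{for all }u\in U,\ y\in Y .$$ Let $F\colon\ell_2(\mathcal I)\to U$, $F\mathbf v=\sum_{i\in\mathcal I}\mathbf v_i\varphi_i$, and $H_\Phi=\operatorname{ran}(\mathcal D F)\subset H$. Then, with constants independent of $J$: (i) $\mathcal D F\colon\ell_2(\mathcal I)\to H$ is uniformly well-conditioned as a mapping from $\ker(F)^\perp$ to $H_\Phi$; that is, $\mathcal DF|_{\ker(F)^\perp}\colon \ker(F)^\perp\to H_\Phi$ is an isomorphism and its condition number $\|\mathcal DF|_{\ker(F)^\perp}\|\,\|(\mathcal DF|_{\ker(F)^\perp})^{-1}\|$ (with respect to the $\ell_2$-norm and the $H$-norm) is bounded independently of $J$. (ii) In both settings (E) and (LS) described in the context, the bilinear form $(h,\tilde h)\mapsto\langle h,\tilde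 h\rangle_y$ is bounded and elliptic on $H_\Phi$ uniformly in $y\in Y$; that is, there are constants $0<c\le C<\infty$, independent of $y\in Y$ and of $J$, such that $|\langle h,\tilde h\rangle_y|\le C\|h\|_H\|\tilde h\|_H$ and $\langle h,h\rangle_y\ge c\|h\|_H^2$ for all $h,\tilde h\in H_\Phi$ and all $y\in Y$.
   Context: All spaces are real. $\Omega\subset\mathbb R^d$ is a domain, $Y$ is a parameter set, $U$ is a Hilbert space, and $H=(L_2(\Omega))^m$ for some $m\in\mathbb N$. The linear map $\mathcal D\colon U\to H$ does not depend on $y$, is bounded and injective, and is an isomorphism (bounded with bounded inverse) from $U$ onto $\operatorname{ran}(\mathcal D)\subset H$. For each $y\in Y$, $\langle\cdot,\cdot\rangle_y$ is a bilinear form on $H$. Frame: $\Phi=\{\varphi_i: i\in\mathcal I\}\subset U$ is a frame for $U_\Phi=\overline{\operatorname{span}\Phi}\subset U$ (with the norm of $U$) with frame constants $c_\Phi,C_\Phi>0$ if $$c_\Phi^2\|h\|_{U_\Phi'}^2\le\sum_{i\in\mathcal I}|h(\varphi_i)|^2\le C_\Phi^2\|h\|_{U_\Phi'}^2\quad\text{for all }h\in U_\Phi',$$ where $U_\Phi'$ is the dual space of $U_\Phi$ with its dual norm. For the settings (E) and (LS), let $a_y\in L_\infty(\Omega)$, $y\in Y$, with constants $0<a_1\le a_\infty<\infty$ such that $a_1\le a_y(x)\le a_\infty$ for all $x\in\Omega$, $y\in Y$. Setting (E): $U=H^1_0(\Omega)$, $m=d$, $\mathcal D=\nabla$, and $\langle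 g,h\rangle_y=\langle a_y g,h\rangle_{(L_2(\Omega))^d}$. Setting (LS): $U=H^1_0(\Omega)\times H(\operatorname{div},\Omega)$, $m=2d+1$, $\mathcal D(v,\tau)=(\nabla v,\tau,\operatorname{div}\tau)$, and for $(g,\tau,p),(h,\rho,q)\in (L_2(\Omega))^d\times(L_2(\Omega))^d\times L_2(\Omega)$, $$\langle(g,\tau,p),(h,\rho,q)\rangle_y=\langle p,q\rangle_{L_2(\Omega)}+\langle a_y^{-1}\tau-g,\;a_y^{-1}\rho-h\rangle_{(L_2(\Omega))^d}.$$ *)

theory Defs
  imports "HOL-Analysis.Analysis" "HOL-Analysis.Finite_Function_Topology"
begin

section \<open>The space $L_2$\<close>

definition square_integrable :: "('a::euclidean_space \<Rightarrow> real) \<Rightarrow> bool" where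
  "square_integrable f \<longleftrightarrow>
     f \<in> borel_measurable lebesgue \<and> integrable lebesgue (\<lambda>x. (f x)\<^sup>2)"

lemma square_integrable_zero [simp]: "square_integrable (\<lambda>_. 0)"
  by (simp add: square_integrable_def)

lemma square_integrable_mult:
  assumes "square_integrable f" "square_integrable g"
  shows "integrable lebesgue (\<lambda>x. f x * g x)"
proof (rule Bochner_Integration.integrable_bound)
  show "integrable lebesgue (\<lambda>x. (f x)\<^sup>2 + (g x)\<^sup>2)"
    using assms by (auto simp: square_integrable_def)
  show "(\<lambda>x. f x * g x) \<in> borel_measurable lebesgue"
    using assms by (auto simp: square_integrable_def)
  have "\<bar>a * b\<bar> \<le> a\<^sup>2 + b\<^sup>2" for a b :: real
  proof -
    have "2 * (\<bar>a\<bar> * \<bar>b\<bar>) \<le> a\<^sup>2 + b\<^sup>2"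
      using sum_squares_bound[of "\<bar>a\<bar>" "\<bar>b\<bar>"] by (simp add: mult.assoc)
    moreover have "0 \<le> \<bar>a\<bar> * \<bar>b\<bar>" by simp
    ultimately show ?thesis unfolding abs_mult by linarith
  qed
  then show "AE x in lebesgue. norm (f x * g x) \<le> norm ((f x)\<^sup>2 + (g x)\<^sup>2)"
    by simp
qed

lemma square_integrable_add:
  assumes "square_integrable f" "square_integrable g"
  shows "square_integrable (\<lambda>x. f x + g x)"
proof -
  have "integrable lebesgue (\<lambda>x. (f x)\<^sup>2 + (g x)\<^sup>2 + 2 * (f x * g x))"
    using assms square_integrable_mult[OF assms]
    by (auto simp: square_integrable_def)
  then show ?thesis
    using assms by (auto simp: square_integrable_def power2_sum mult.assoc)
qed

lemma square_integrable_scale: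
  "square_integrable f \<Longrightarrow> square_integrable (\<lambda>x. c * f x)"
  by (auto simp: square_integrable_def power_mult_distrib)

definition L2_rel :: "('a::euclidean_space \<Rightarrow> real) \<Rightarrow> ('a \<Rightarrow> real) \<Rightarrow> bool" where
  "L2_rel f g \<longleftrightarrow>
     square_integrable f \<and> square_integrable g \<and> (AE x in lebesgue. f x = g x)"

quotient_type (overloaded) 'a L2 = "'a::euclidean_space \<Rightarrow> real" / partial: L2_rel
proof (rule part_equivpI)
  show "\<exists>x. L2_rel x x"
    by (rule exI[of _ "\<lambda>_. 0"]) (simp add: L2_rel_def)
  show "symp L2_rel"
    by (auto intro!: sympI simp: L2_rel_def)
  show "transp L2_rel"
    by (rule transpI, unfold L2_rel_def, auto)
qed

instantiation L2 :: (euclidean_space) real_vector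
begin

lift_definition zero_L2 :: "'a L2" is "\<lambda>_. 0"
  by (simp add: L2_rel_def)

lift_definition plus_L2 :: "'a L2 \<Rightarrow> 'a L2 \<Rightarrow> 'a L2" is "\<lambda>f g x. f x + g x"
  by (auto simp: L2_rel_def square_integrable_add)

lift_definition scaleR_L2 :: "real \<Rightarrow> 'a L2 \<Rightarrow> 'a L2" is "\<lambda>c f x. c * f x"
  by (auto simp: L2_rel_def square_integrable_scale)

definition uminus_L2 :: "'a L2 \<Rightarrow> 'a L2" where "uminus_L2 f = (- 1) *\<^sub>R f"

definition minus_L2 :: "'a L2 \<Rightarrow> 'a L2 \<Rightarrow> 'a L2" where "minus_L2 f g = f + - g"

instance
proof
  fix a b c :: "'a L2" and r s :: real
  show "a + b + c = a + (b + c)"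
    by transfer (auto simp: L2_rel_def square_integrable_add add.assoc)
  show "a + b = b + a"
    by transfer (auto simp: L2_rel_def square_integrable_add add.commute)
  show "0 + a = a"
    by transfer (auto simp: L2_rel_def)
  show "- a + a = 0"
    unfolding uminus_L2_def
    by transfer (auto simp: L2_rel_def)
  show "a - b = a + - b"
    by (simp add: minus_L2_def)
  show "r *\<^sub>R (a + b) = r *\<^sub>R a + r *\<^sub>R b"
    by transfer (auto simp: L2_rel_def square_integrable_add square_integrable_scale algebra_simps
        intro!: square_integrable_add[OF square_integrable_scale square_integrable_scale])
  show "(r + s) *\<^sub>R a = r *\<^sub>R a + s *\<^sub>R a"
    by transfer (auto simp: L2_rel_def square_integrable_add square_integrable_scale algebra_simps
        intro!: square_integrable_add[OF square_integrable_scale square_integrable_scale])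
  show "r *\<^sub>R s *\<^sub>R a = (r * s) *\<^sub>R a"
    by transfer (auto simp: L2_rel_def mult.assoc intro!: square_integrable_scale)
  show "1 *\<^sub>R a = a"
    by transfer (auto simp: L2_rel_def)
qed

end

instantiation L2 :: (euclidean_space) real_inner
begin

lift_definition inner_L2 :: "'a L2 \<Rightarrow> 'a L2 \<Rightarrow> real" is
  "\<lambda>f g. integral\<^sup>L lebesgue (\<lambda>x. f x * g x)"
  by (rule integral_cong_AE) (auto simp: L2_rel_def square_integrable_def)

definition norm_L2 :: "'a L2 \<Rightarrow> real" where "norm_L2 f = sqrt (inner f f)"

definition sgn_L2 :: "'a L2 \<Rightarrow> 'a L2" where "sgn_L2 f = f /\<^sub>R norm f"

definition dist_L2 :: "'a L2 \<Rightarrow> 'a L2 \<Rightarrow> real" where "dist_L2 f g = norm (f - g)"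

definition uniformity_L2 :: "('a L2 \<times> 'a L2) filter" where
  "uniformity_L2 = (INF e\<in>{0<..}. principal {(x, y). dist x y < e})"

definition open_L2 :: "'a L2 set \<Rightarrow> bool" where
  "open_L2 S = (\<forall>x\<in>S. \<forall>\<^sub>F (x', y) in uniformity. x' = x \<longrightarrow> y \<in> S)"

instance
proof
  fix a b c :: "'a L2" and r :: real and S :: "'a L2 set"
  show "dist a b = norm (a - b)" by (rule dist_L2_def)
  show "sgn a = a /\<^sub>R norm a" by (rule sgn_L2_def)
  show "uniformity = (INF e\<in>{0<..}. principal {(x, y::'a L2). dist x y < e})"
    by (rule uniformity_L2_def)
  show "open S = (\<forall>x\<in>S. \<forall>\<^sub>F (x', y) in uniformity. x' = x \<longrightarrow> y \<in> S)"
    by (rule open_L2_def)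
  show "norm a = sqrt (inner a a)" by (rule norm_L2_def)
  show "inner a b = inner b a"
    by transfer (simp add: mult.commute)
  show "inner (a + b) c = inner a c + inner b c"
    by transfer (auto simp: L2_rel_def distrib_right square_integrable_mult)
  show "inner (r *\<^sub>R a) b = r * inner a b"
    by transfer (auto simp: mult.assoc)
  show "0 \<le> inner a a"
    by transfer simp
  show "(inner a a = 0) = (a = 0)"
    by transfer (auto simp: L2_rel_def square_integrable_def power2_eq_square
        integral_nonneg_eq_0_iff_AE)
qed

end

text \<open>The class of a square integrable function; junk value 0 otherwise.\<close>

lift_definition L2_of :: "('a::euclidean_space \<Rightarrow> real) \<Rightarrow> 'a L2" is
  "\<lambda>f. if square_integrable f then f else (\<lambda>_. 0)"
  by (auto simp: L2_rel_def)

lemma inner_L2_of: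
  "square_integrable f \<Longrightarrow> square_integrable g \<Longrightarrow>
   inner (L2_of f) (L2_of g) = integral\<^sup>L lebesgue (\<lambda>x. f x * g x)"
  by transfer auto

lemma L2_of_eq_iff:
  "square_integrable f \<Longrightarrow> square_integrable g \<Longrightarrow>
   L2_of f = L2_of g \<longleftrightarrow> (AE x in lebesgue. f x = g x)"
  by transfer (auto simp: L2_rel_def)

lemma square_integrable_rep_L2: "square_integrable (rep_L2 f)"
  using Quotient_rep_reflp[OF Quotient_L2] Quotient3_rep_reflp[OF Quotient3_L2]
  by (auto simp: L2_rel_def)

lemma L2_of_rep_L2: "L2_of (rep_L2 f) = f"
  using Quotient3_abs_rep[OF Quotient3_L2, of f]
  by (simp add: L2_of_def square_integrable_rep_L2)

text \<open>$L_2(\Omega)$ is identified, through extension by zero, with the subspace of those elements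
  of $L_2(\mathbb R^d)$ that vanish almost everywhere outside $\Omega$.\<close>

definition L2_on :: "'a::euclidean_space set \<Rightarrow> 'a L2 set" where
  "L2_on \<Omega> = {f. AE x in lebesgue. x \<notin> \<Omega> \<longrightarrow> rep_L2 f x = 0}"

definition L2_vec :: "'a::euclidean_space set \<Rightarrow> ('a L2 ^ 'm) set" where
  "L2_vec \<Omega> = {f. \<forall>i. f $ i \<in> L2_on \<Omega>}"

definition mult_on ::
    "'a::euclidean_space set \<Rightarrow> ('a \<Rightarrow> real) \<Rightarrow> 'a L2 ^ 'm \<Rightarrow> 'a L2 ^ 'm" where
  "mult_on \<Omega> \<alpha> g = (\<chi> i. L2_of (\<lambda>x. indicator \<Omega> x * \<alpha> x * rep_L2 (g $ i) x))"


section \<open>Sobolev spaces\<close>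

definition pderiv_at :: "'d \<Rightarrow> (real ^ 'd \<Rightarrow> real) \<Rightarrow> real ^ 'd \<Rightarrow> real" where
  "pderiv_at i f x = frechet_derivative f (at x) (axis i 1)"

primrec C_k :: "nat \<Rightarrow> (real ^ 'd \<Rightarrow> real) \<Rightarrow> bool" where
  "C_k 0 f \<longleftrightarrow> continuous_on UNIV f"
| "C_k (Suc k) f \<longleftrightarrow> (\<forall>x. f differentiable (at x)) \<and> (\<forall>i. C_k k (pderiv_at i f))"

definition test_functions :: "(real ^ 'd) set \<Rightarrow> (real ^ 'd \<Rightarrow> real) set" where
  "test_functions \<Omega> =
     {f. (\<forall>k. C_k k f) \<and> compact (closure {x. f x \<noteq> 0}) \<and> closure {x. f x \<noteq> 0} \<subseteq> \<Omega>}"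

definition is_weak_grad :: "(real ^ 'd) set \<Rightarrow> (real ^ 'd) L2 \<Rightarrow> (real ^ 'd) L2 ^ 'd \<Rightarrow> bool" where
  "is_weak_grad \<Omega> u g \<longleftrightarrow> g \<in> L2_vec \<Omega> \<and>
     (\<forall>\<phi>\<in>test_functions \<Omega>. \<forall>i.
        inner u (L2_of (pderiv_at i \<phi>)) = - inner (g $ i) (L2_of \<phi>))"

definition is_weak_div :: "(real ^ 'd) set \<Rightarrow> (real ^ 'd) L2 ^ 'd \<Rightarrow> (real ^ 'd) L2 \<Rightarrow> bool" where
  "is_weak_div \<Omega> \<tau> p \<longleftrightarrow> p \<in> L2_on \<Omega> \<and>
     (\<forall>\<phi>\<in>test_functions \<Omega>.
        inner \<tau> (\<chi> i. L2_of (pderiv_at i \<phi>)) = - inner p (L2_of \<phi>))"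

text \<open>For open \<open>\<Omega>\<close> a weak gradient or divergence is unique as an element of $L_2$, so the
  descriptions below are proper on $H^1(\Omega)$ and $H(\mathrm{div},\Omega)$.\<close>

definition weak_grad :: "(real ^ 'd) set \<Rightarrow> (real ^ 'd) L2 \<Rightarrow> (real ^ 'd) L2 ^ 'd" where
  "weak_grad \<Omega> u = (THE g. is_weak_grad \<Omega> u g)"

definition weak_div :: "(real ^ 'd) set \<Rightarrow> (real ^ 'd) L2 ^ 'd \<Rightarrow> (real ^ 'd) L2" where
  "weak_div \<Omega> \<tau> = (THE p. is_weak_div \<Omega> \<tau> p)"

definition H1 :: "(real ^ 'd) set \<Rightarrow> (real ^ 'd) L2 set" where
  "H1 \<Omega> = {u \<in> L2_on \<Omega>. \<exists>g. is_weak_grad \<Omega> u g}"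

definition H1_inner :: "(real ^ 'd) set \<Rightarrow> (real ^ 'd) L2 \<Rightarrow> (real ^ 'd) L2 \<Rightarrow> real" where
  "H1_inner \<Omega> u v = inner u v + inner (weak_grad \<Omega> u) (weak_grad \<Omega> v)"

definition Hdiv :: "(real ^ 'd) set \<Rightarrow> ((real ^ 'd) L2 ^ 'd) set" where
  "Hdiv \<Omega> = {\<tau> \<in> L2_vec \<Omega>. \<exists>p. is_weak_div \<Omega> \<tau> p}"

definition Hdiv_inner ::
    "(real ^ 'd) set \<Rightarrow> (real ^ 'd) L2 ^ 'd \<Rightarrow> (real ^ 'd) L2 ^ 'd \<Rightarrow> real" where
  "Hdiv_inner \<Omega> \<sigma> \<tau> = inner \<sigma> \<tau> + inner (weak_div \<Omega> \<sigma>) (weak_div \<Omega> \<tau>)"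

definition ip_norm :: "('u \<Rightarrow> 'u \<Rightarrow> real) \<Rightarrow> 'u \<Rightarrow> real" where
  "ip_norm ip u = sqrt (ip u u)"

text \<open>$H^1_0(\Omega)$ is the closure of the test functions in $H^1(\Omega)$.\<close>

definition H10 :: "(real ^ 'd) set \<Rightarrow> (real ^ 'd) L2 set" where
  "H10 \<Omega> = {u \<in> H1 \<Omega>. \<forall>\<epsilon>>0. \<exists>\<phi>\<in>test_functions \<Omega>. ip_norm (H1_inner \<Omega>) (u - L2_of \<phi>) < \<epsilon>}"


section \<open>Operators between subspaces\<close>

text \<open>Normed spaces whose norm need not be the one of the ambient type are given by a carrier
  (a linear subspace of a real vector space) together with a norm or an inner product on it.\<close>

definition linear_map_on ::
    "'u::real_vector set \<Rightarrow> ('u \<Rightarrow> 'w::real_vector) \<Rightarrow> bool" where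
  "linear_map_on V T \<longleftrightarrow>
     (\<forall>u\<in>V. \<forall>v\<in>V. T (u + v) = T u + T v) \<and> (\<forall>r. \<forall>u\<in>V. T (r *\<^sub>R u) = r *\<^sub>R T u)"

definition hilbert_space_on :: "'u::real_vector set \<Rightarrow> ('u \<Rightarrow> 'u \<Rightarrow> real) \<Rightarrow> bool" where
  "hilbert_space_on V ip \<longleftrightarrow>
     subspace V \<and>
     (\<forall>u\<in>V. \<forall>v\<in>V. ip u v = ip v u) \<and>
     (\<forall>v\<in>V. linear_map_on V (\<lambda>u. ip u v)) \<and>
     (\<forall>u\<in>V. u \<noteq> 0 \<longrightarrow> 0 < ip u u) \<and>
     (\<forall>X. (\<forall>n::nat. X n \<in> V) \<and>
          (\<forall>\<epsilon>>0. \<exists>N. \<forall>m\<ge>N. \<forall>n\<ge>N. ip_norm ip (X m - X n) < \<epsilon>) \<longrightarrow>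
          (\<exists>u\<in>V. (\<lambda>n. ip_norm ip (X n - u)) \<longlonglongrightarrow> 0))"

definition bounded_linear_map_on ::
    "'u::real_vector set \<Rightarrow> ('u \<Rightarrow> real) \<Rightarrow> ('w::real_vector \<Rightarrow> real) \<Rightarrow> ('u \<Rightarrow> 'w) \<Rightarrow> bool" where
  "bounded_linear_map_on V nV nW T \<longleftrightarrow>
     linear_map_on V T \<and> (\<exists>K. \<forall>u\<in>V. nW (T u) \<le> K * nV u)"

definition op_norm_on ::
    "'u set \<Rightarrow> ('u \<Rightarrow> real) \<Rightarrow> ('w \<Rightarrow> real) \<Rightarrow> ('u \<Rightarrow> 'w) \<Rightarrow> real" where
  "op_norm_on V nV nW T = (SUP u\<in>{u \<in> V. nV u \<le> 1}. nW (T u))"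

definition isomorphism_on ::
    "'u::real_vector set \<Rightarrow> ('u \<Rightarrow> real) \<Rightarrow> 'w::real_vector set \<Rightarrow> ('w \<Rightarrow> real) \<Rightarrow> ('u \<Rightarrow> 'w) \<Rightarrow> bool"
  where
  "isomorphism_on V nV W nW T \<longleftrightarrow>
     bij_betw T V W \<and> bounded_linear_map_on V nV nW T \<and>
     bounded_linear_map_on W nW nV (inv_into V T)"

definition condition_number_on ::
    "'u set \<Rightarrow> ('u \<Rightarrow> real) \<Rightarrow> 'w set \<Rightarrow> ('w \<Rightarrow> real) \<Rightarrow> ('u \<Rightarrow> 'w) \<Rightarrow> real" where
  "condition_number_on V nV W nW T =
     op_norm_on V nV nW T * op_norm_on W nW nV (inv_into V T)"

definition bilinear_form_on :: "'w::real_vector set \<Rightarrow> ('w \<Rightarrow> 'w \<Rightarrow> real) \<Rightarrow> bool" where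
  "bilinear_form_on V B \<longleftrightarrow>
     (\<forall>h\<in>V. linear_map_on V (B h)) \<and> (\<forall>h\<in>V. linear_map_on V (\<lambda>g. B g h))"


section \<open>Frames\<close>

definition dual_space_on :: "'u::real_vector set \<Rightarrow> ('u \<Rightarrow> real) \<Rightarrow> ('u \<Rightarrow> real) set" where
  "dual_space_on V nV = {h. bounded_linear_map_on V nV abs h}"

text \<open>The frame inequalities are stated for finite index sets only, for which the span is closed.\<close>

definition is_frame ::
    "('u::real_vector \<Rightarrow> real) \<Rightarrow> 'i set \<Rightarrow> ('i \<Rightarrow> 'u) \<Rightarrow> real \<Rightarrow> real \<Rightarrow> bool" where
  "is_frame nU I \<phi> c C \<longleftrightarrow>
     finite I \<and> 0 < c \<and> 0 < C \<and>
     (\<forall>h\<in>dual_space_on (span (\<phi> ` I)) nU.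
        c\<^sup>2 * (op_norm_on (span (\<phi> ` I)) nU abs h)\<^sup>2 \<le> (\<Sum>i\<in>I. \<bar>h (\<phi> i)\<bar>\<^sup>2) \<and>
        (\<Sum>i\<in>I. \<bar>h (\<phi> i)\<bar>\<^sup>2) \<le> C\<^sup>2 * (op_norm_on (span (\<phi> ` I)) nU abs h)\<^sup>2)"

definition uniform_frame_family ::
    "'u::real_vector set \<Rightarrow> ('u \<Rightarrow> real) \<Rightarrow> (nat \<Rightarrow> 'i set) \<Rightarrow> (nat \<Rightarrow> 'i \<Rightarrow> 'u) \<Rightarrow>
     (nat \<Rightarrow> real) \<Rightarrow> (nat \<Rightarrow> real) \<Rightarrow> bool" where
  "uniform_frame_family U nU I \<Phi> c C \<longleftrightarrow>
     (\<forall>J. \<Phi> J ` I J \<subseteq> U \<and> is_frame nU (I J) (\<Phi> J) (c J) (C J)) \<and>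
     bdd_above (range (\<lambda>J. C J / c J))"

text \<open>$\ell_2(I)$ consists of the finitely supported functions with support in the finite set
  \<open>I\<close>. Its norm is \<open>ell2_norm\<close>, not the library's norm on \<^typ>\<open>('i, real) poly_mapping\<close>, which is the
  $\ell_1$-norm.\<close>

definition ell2 :: "'i set \<Rightarrow> ('i, real) poly_mapping set" where
  "ell2 I = {v. Poly_Mapping.keys v \<subseteq> I}"

definition ell2_norm :: "'i set \<Rightarrow> ('i, real) poly_mapping \<Rightarrow> real" where
  "ell2_norm I v = L2_set (Poly_Mapping.lookup v) I"

definition synthesis :: "'i set \<Rightarrow> ('i \<Rightarrow> 'u::real_vector) \<Rightarrow> ('i, real) poly_mapping \<Rightarrow> 'u" where
  "synthesis I \<phi> v = (\<Sum>i\<in>I. Poly_Mapping.lookup v i *\<^sub>R \<phi> i)"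

definition ker_perp :: "'i set \<Rightarrow> ('i \<Rightarrow> 'u::real_vector) \<Rightarrow> ('i, real) poly_mapping set" where
  "ker_perp I \<phi> =
     {v \<in> ell2 I. \<forall>w\<in>ell2 I. synthesis I \<phi> w = 0 \<longrightarrow>
        (\<Sum>i\<in>I. Poly_Mapping.lookup v i * Poly_Mapping.lookup w i) = 0}"

definition H_frame :: "('u::real_vector \<Rightarrow> 'h) \<Rightarrow> 'i set \<Rightarrow> ('i \<Rightarrow> 'u) \<Rightarrow> 'h set" where
  "H_frame D I \<phi> = (D \<circ> synthesis I \<phi>) ` ell2 I"


section \<open>Parametric problems\<close>

definition domain :: "(real ^ 'd) set \<Rightarrow> bool" where
  "domain \<Omega> \<longleftrightarrow> open \<Omega> \<and> connected \<Omega> \<and> \<Omega> \<noteq> {}"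

definition parametric_setting ::
    "(real ^ 'd) set \<Rightarrow> 'u::real_vector set \<Rightarrow> ('u \<Rightarrow> real) \<Rightarrow> ('u \<Rightarrow> (real ^ 'd) L2 ^ 'm) \<Rightarrow>
     'y set \<Rightarrow> ('y \<Rightarrow> (real ^ 'd) L2 ^ 'm \<Rightarrow> (real ^ 'd) L2 ^ 'm \<Rightarrow> real) \<Rightarrow> real \<Rightarrow> real \<Rightarrow> bool" where
  "parametric_setting \<Omega> U nU D Y B cU CU \<longleftrightarrow>
     D ` U \<subseteq> L2_vec \<Omega> \<and> isomorphism_on U nU (D ` U) norm D \<and>
     0 < cU \<and> cU \<le> CU \<and>
     (\<forall>u\<in>U. \<forall>y\<in>Y. cU * (nU u)\<^sup>2 \<le> B y (D u) (D u) \<and> B y (D u) (D u) \<le> CU * (nU u)\<^sup>2)"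

definition uniformly_well_conditioned ::
    "('u::real_vector \<Rightarrow> 'h::real_normed_vector) \<Rightarrow> (nat \<Rightarrow> 'i set) \<Rightarrow> (nat \<Rightarrow> 'i \<Rightarrow> 'u) \<Rightarrow> bool" where
  "uniformly_well_conditioned D I \<Phi> \<longleftrightarrow>
     (\<exists>\<kappa>. \<forall>J.
        isomorphism_on (ker_perp (I J) (\<Phi> J)) (ell2_norm (I J))
          (H_frame D (I J) (\<Phi> J)) norm (D \<circ> synthesis (I J) (\<Phi> J)) \<and>
        condition_number_on (ker_perp (I J) (\<Phi> J)) (ell2_norm (I J))
          (H_frame D (I J) (\<Phi> J)) norm (D \<circ> synthesis (I J) (\<Phi> J)) \<le> \<kappa>)"

definition uniformly_bounded_elliptic ::
    "'y set \<Rightarrow> ('y \<Rightarrow> 'h \<Rightarrow> 'h \<Rightarrow> real) \<Rightarrow> (nat \<Rightarrow> 'h::real_normed_vector set) \<Rightarrow> bool" where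
  "uniformly_bounded_elliptic Y B V \<longleftrightarrow>
     (\<exists>c C. 0 < c \<and> c \<le> C \<and>
        (\<forall>J. \<forall>y\<in>Y. \<forall>h\<in>V J.
           (\<forall>h'\<in>V J. \<bar>B y h h'\<bar> \<le> C * norm h * norm h') \<and> B y h h \<ge> c * (norm h)\<^sup>2))"

definition admissible_coefficients ::
    "(real ^ 'd) set \<Rightarrow> 'y set \<Rightarrow> ('y \<Rightarrow> real ^ 'd \<Rightarrow> real) \<Rightarrow> real \<Rightarrow> real \<Rightarrow> bool" where
  "admissible_coefficients \<Omega> Y a a1 ainf \<longleftrightarrow>
     0 < a1 \<and> a1 \<le> ainf \<and>
     (\<forall>y\<in>Y. a y \<in> borel_measurable (lebesgue_on \<Omega>) \<and> (\<forall>x\<in>\<Omega>. a1 \<le> a y x \<and> a y x \<le> ainf))"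

definition form_E ::
    "(real ^ 'd) set \<Rightarrow> ('y \<Rightarrow> real ^ 'd \<Rightarrow> real) \<Rightarrow> 'y \<Rightarrow>
     (real ^ 'd) L2 ^ 'd \<Rightarrow> (real ^ 'd) L2 ^ 'd \<Rightarrow> real" where
  "form_E \<Omega> a y g h = inner (mult_on \<Omega> (a y) g) h"

definition U_LS :: "(real ^ 'd) set \<Rightarrow> ((real ^ 'd) L2 \<times> ((real ^ 'd) L2 ^ 'd)) set" where
  "U_LS \<Omega> = H10 \<Omega> \<times> Hdiv \<Omega>"

definition inner_LS ::
    "(real ^ 'd) set \<Rightarrow> (real ^ 'd) L2 \<times> ((real ^ 'd) L2 ^ 'd) \<Rightarrow>
     (real ^ 'd) L2 \<times> ((real ^ 'd) L2 ^ 'd) \<Rightarrow> real" where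
  "inner_LS \<Omega> u v = H1_inner \<Omega> (fst u) (fst v) + Hdiv_inner \<Omega> (snd u) (snd v)"

text \<open>The $2d+1$ components of $(g,\tau,p)$ are indexed by \<^typ>\<open>'d + 'd + unit\<close>.\<close>

definition triple :: "'a ^ 'd \<Rightarrow> 'a ^ 'd \<Rightarrow> 'a \<Rightarrow> 'a ^ ('d + 'd + unit)" where
  "triple g \<tau> p = (\<chi> k. case k of Inl i \<Rightarrow> g $ i | Inr (Inl i) \<Rightarrow> \<tau> $ i | Inr (Inr _) \<Rightarrow> p)"

definition comp_g :: "'a ^ ('d::finite + 'd + unit) \<Rightarrow> 'a ^ 'd" where
  "comp_g h = (\<chi> i. h $ Inl i)"

definition comp_\<tau> :: "'a ^ ('d::finite + 'd + unit) \<Rightarrow> 'a ^ 'd" where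
  "comp_\<tau> h = (\<chi> i. h $ Inr (Inl i))"

definition comp_p :: "'a ^ ('d::finite + 'd + unit) \<Rightarrow> 'a" where
  "comp_p h = h $ Inr (Inr ())"

lemma comp_triple [simp]:
  fixes g \<tau> :: "'a ^ 'd::finite"
  shows "comp_g (triple g \<tau> p) = g" "comp_\<tau> (triple g \<tau> p) = \<tau>" "comp_p (triple g \<tau> p) = p"
  by (simp_all add: comp_g_def comp_\<tau>_def comp_p_def triple_def vec_eq_iff)

definition D_LS ::
    "(real ^ 'd) set \<Rightarrow> (real ^ 'd) L2 \<times> ((real ^ 'd) L2 ^ 'd) \<Rightarrow> (real ^ 'd) L2 ^ ('d + 'd + unit)" where
  "D_LS \<Omega> u = triple (weak_grad \<Omega> (fst u)) (snd u) (weak_div \<Omega> (snd u))"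

definition form_LS ::
    "(real ^ 'd) set \<Rightarrow> ('y \<Rightarrow> real ^ 'd \<Rightarrow> real) \<Rightarrow> 'y \<Rightarrow>
     (real ^ 'd) L2 ^ ('d + 'd + unit) \<Rightarrow> (real ^ 'd) L2 ^ ('d + 'd + unit) \<Rightarrow> real" where
  "form_LS \<Omega> a y h k =
     inner (comp_p h) (comp_p k) +
     inner (mult_on \<Omega> (\<lambda>x. inverse (a y x)) (comp_\<tau> h) - comp_g h)
           (mult_on \<Omega> (\<lambda>x. inverse (a y x)) (comp_\<tau> k) - comp_g k)"

end

theory Submission
  imports Defs
begin

text \<open>Let $F^*u = (\langle u, \varphi_i\rangle)_i$. Testing the frame inequalities with the functionals
  $\langle u, \cdot\rangle$, $u \in U_\Phi$, gives $c_\Phi \|u\| \le \|F^* u\| \le C_\Phi \|u\|$. The upper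
  bound is $\|F\| \le C_\Phi$ by duality. By the lower bound $F F^*$ is injective, hence surjective on
  the finite-dimensional space $U_\Phi$, so $\ker(F)^\perp = \mathrm{ran}\, F^*$; for $v = F^* u$ one gets
  $\|v\|^2 = \langle u, F v\rangle \le c_\Phi^{-1} \|v\| \|F v\|$. Thus $F$ has condition number at most
  $C_\Phi / c_\Phi$ on $\ker(F)^\perp$, and composing with the isomorphism $\mathcal D$ costs a constant factor.

  Ellipticity on $H_\Phi$ follows from $\langle \mathcal D u, \mathcal D u\rangle_y \ge c_U \|u\|^2 \ge
  c_U \|\mathcal D\|^{-2} \|\mathcal D u\|^2$ once finite combinations of the $\varphi_i$ are known to lie
  in $U$. For $U$ built from $H^1_0(\Omega)$ this requires that weak gradients are unique (the fundamental
  lemma of the calculus of variations) and that test functions have their classical gradient as weak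
  gradient (integration by parts). Boundedness only uses the bounds on the coefficients $a_y$.\<close>

section \<open>Finite frames in an inner product space\<close>

text \<open>Rank-nullity for a map that is linear only on \<open>span S\<close>. It is replaced by
  the globally linear \<open>L\<close> that agrees with it on a basis \<open>B\<close>; by
  injectivity \<open>L\<close> maps \<open>B\<close> to equally many independent vectors of
  \<open>span B\<close>, and these must span.\<close>

lemma linear_map_on_span_surj:
  fixes T :: "'u::real_vector \<Rightarrow> 'u"
  assumes "finite S" and T: "linear_map_on (span S) T" and sub: "T ` span S \<subseteq> span S"
    and ker: "\<And>u. u \<in> span S \<Longrightarrow> T u = 0 \<Longrightarrow> u = 0"
  shows "T ` span S = span S"
proof -
  obtain B where B: "B \<subseteq> S" "independent B" "S \<subseteq> span B"
    using maximal_independent_subset[of S] by auto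
  have fB: "finite B" using B(1) assms(1) finite_subset by blast
  have sB: "span B = span S"
    using B by (metis span_mono span_span subset_antisym)
  define L where "L = construct B T"
  have L: "linear L" using linear_construct[OF B(2)] by (simp add: L_def)
  have Lb: "L b = T b" if "b \<in> B" for b using construct_basis[OF B(2) that] by (simp add: L_def)
  \<comment> \<open>Membership is part of the induction claim because additivity of \<open>T\<close>
    is known only on the span.\<close>
  have LT': "x \<in> span B \<and> L x = T x" if "x \<in> span B" for x
    using that
  proof (induction rule: span_induct_alt)
    case base
    have "T 0 = T (0 *\<^sub>R 0)" by simp
    also have "\<dots> = 0" using T span_0 unfolding linear_map_on_def by (metis scaleR_zero_left)
    finally show ?case using linear_0[OF L] by (simp add: span_0)
  next
    case (step c b y)
    have "L (c *\<^sub>R b + y) = c *\<^sub>R T b + T y"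
      using step Lb by (simp add: linear_add[OF L] linear_scale[OF L])
    also have "\<dots> = T (c *\<^sub>R b + y)"
      using T step sB span_base[of b B] span_scale[of b B c] unfolding linear_map_on_def by auto
    finally show ?case using step span_base[of b B] by (simp add: span_add span_scale)
  qed
  then have LT: "L x = T x" if "x \<in> span B" for x using that by blast
  have inj: "inj_on L (span B)"
    using LT ker sB by (subst linear_inj_on_iff_eq_0[OF L]) (auto simp: subspace_span)
  have "independent (L ` B)"
    using linear_independent_injective_image[OF L B(2)] inj by blast
  moreover have "card (L ` B) = card B"
    by (intro card_image inj_on_subset[OF inj] span_superset)
  moreover have LB: "L ` B \<subseteq> span B"
    using Lb sub sB span_base[of _ B] by (auto simp: image_subset_iff)
  \<comment> \<open>A vector outside would enlarge the image of \<open>B\<close> to an independent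
    set of \<open>card B + 1\<close> vectors inside \<open>span B\<close>.\<close>
  moreover have "span B \<subseteq> span (L ` B)"
  proof (rule ccontr)
    assume "\<not> span B \<subseteq> span (L ` B)"
    then obtain x where x: "x \<in> span B" "x \<notin> span (L ` B)" by blast
    then have "independent (insert x (L ` B))"
      using \<open>independent (L ` B)\<close> by (simp add: independent_insert)
    then have "card (insert x (L ` B)) \<le> card B"
      by (intro independent_span_bound[OF fB, THEN conjunct2] insert_subsetI x(1) LB)
    moreover have "x \<notin> L ` B" using x span_base[of x "L ` B"] by blast
    ultimately show False using fB \<open>card (L ` B) = card B\<close> by simp
  qed
  moreover have "span (L ` B) = L ` span B" by (rule linear_span_image[OF L])
  ultimately have "L ` span B = span B" using span_mono[OF LB] by (auto simp: span_span)
  then show ?thesis using LT sB by (metis image_cong)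
qed

text \<open>The algebraic laws of \<open>hilbert_space_on\<close>, relative to the carrier. The
  ambient type is only a \<open>real_vector\<close>, so the elementary theory of inner products is
  derived from these laws.\<close>

locale inner_product_on =
  fixes V :: "'u::real_vector set" and ip :: "'u \<Rightarrow> 'u \<Rightarrow> real"
  assumes subspace_V: "subspace V"
    and ip_commute: "\<And>u v. u \<in> V \<Longrightarrow> v \<in> V \<Longrightarrow> ip u v = ip v u"
    and ip_linear: "\<And>v. v \<in> V \<Longrightarrow> linear_map_on V (\<lambda>u. ip u v)"
    and ip_pos: "\<And>u. u \<in> V \<Longrightarrow> u \<noteq> 0 \<Longrightarrow> 0 < ip u u"
begin

lemma ip_linear_right: "u \<in> V \<Longrightarrow> linear_map_on V (ip u)"
  using ip_linear[of u] subspace_add[OF subspace_V] subspace_scale[OF subspace_V] 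
  by (auto simp: linear_map_on_def ip_commute)

lemma ip_0_left: "v \<in> V \<Longrightarrow> ip 0 v = 0"
  using ip_linear[of v] subspace_0[OF subspace_V] unfolding linear_map_on_def
  by (metis scaleR_zero_left)

lemma ip_diff_left: "u \<in> V \<Longrightarrow> v \<in> V \<Longrightarrow> w \<in> V \<Longrightarrow> ip (u - v) w = ip u w - ip v w"
  using ip_linear[of w] subspace_diff[OF subspace_V, of u v]
  unfolding linear_map_on_def by (metis diff_add_cancel eq_diff_eq)

lemma ip_scale_left: "u \<in> V \<Longrightarrow> v \<in> V \<Longrightarrow> ip (r *\<^sub>R u) v = r * ip u v"
  using ip_linear[of v] unfolding linear_map_on_def by simp

lemma ip_nonneg: "u \<in> V \<Longrightarrow> 0 \<le> ip u u"
  using ip_pos[of u] ip_0_left[of u] by (cases "u = 0") auto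

lemma ip_norm_nonneg: "u \<in> V \<Longrightarrow> 0 \<le> ip_norm ip u"
  by (simp add: ip_norm_def ip_nonneg)

lemma ip_norm_sq: "u \<in> V \<Longrightarrow> (ip_norm ip u)\<^sup>2 = ip u u"
  by (simp add: ip_norm_def ip_nonneg)

lemma ip_norm_eq_0: "u \<in> V \<Longrightarrow> ip_norm ip u = 0 \<longleftrightarrow> u = 0"
  using ip_pos[of u] ip_0_left[of u] by (cases "u = 0") (auto simp: ip_norm_def)

lemma ip_norm_scale: "u \<in> V \<Longrightarrow> ip_norm ip (r *\<^sub>R u) = \<bar>r\<bar> * ip_norm ip u"
  using subspace_scale[OF subspace_V, of u r]
  by (simp add: ip_norm_def ip_scale_left ip_commute[of u "r *\<^sub>R u"] real_sqrt_mult)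

lemma ip_Cauchy_Schwarz:
  assumes "u \<in> V" "v \<in> V"
  shows "\<bar>ip u v\<bar> \<le> ip_norm ip u * ip_norm ip v"
proof (cases "v = 0")
  case True
  then show ?thesis using assms ip_0_left[of u] ip_0_left[of 0] by (simp add: ip_commute[of u 0] ip_norm_def)
next
  case False
  then have p: "0 < ip v v" using ip_pos assms by blast
  \<comment> \<open>\<open>t *\<^sub>R v\<close> is the orthogonal projection of \<open>u\<close>
    onto the line through \<open>v\<close>; this choice minimises the square below.\<close>
  define t where "t = ip u v / ip v v"
  have tv: "t *\<^sub>R v \<in> V" using assms subspace_scale[OF subspace_V] by blast
  then have w: "u - t *\<^sub>R v \<in> V" using assms subspace_diff[OF subspace_V] by blast
  have "0 \<le> ip (u - t *\<^sub>R v) (u - t *\<^sub>R v)" using ip_nonneg[OF w] .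
  also have "\<dots> = ip u u - t * ip u v - t * (ip u v - t * ip v v)"
    using assms tv w
    by (simp add: ip_diff_left ip_scale_left ip_commute[of u "u - t *\<^sub>R v"]
        ip_commute[of v "u - t *\<^sub>R v"] ip_commute[of v u])
  also have "\<dots> = ip u u - (ip u v)\<^sup>2 / ip v v"
    using p by (simp add: t_def power2_eq_square field_simps)
  finally have "(ip u v)\<^sup>2 \<le> ip u u * ip v v" using p by (simp add: field_simps)
  then show ?thesis
    using real_sqrt_le_mono[of "(ip u v)\<^sup>2" "ip u u * ip v v"] by (simp add: ip_norm_def real_sqrt_mult)
qed

text \<open>Cauchy-Schwarz bounds the functional, and the normalised \<open>u\<close>, which lies in
  \<open>W\<close>, attains the bound. This converts the dual norm in \<open>is_frame\<close> into
  the norm of \<open>u\<close>.\<close>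

lemma op_norm_on_ip:
  assumes "subspace W" "W \<subseteq> V" "u \<in> W"
  shows "op_norm_on W (ip_norm ip) abs (ip u) = ip_norm ip u"
proof -
  have u: "u \<in> V" using assms by blast
  have bd: "\<bar>ip u w\<bar> \<le> ip_norm ip u" if "w \<in> W" "ip_norm ip w \<le> 1" for w
    using ip_Cauchy_Schwarz[OF u, of w] that assms(2)
      mult_left_mono[OF that(2) ip_norm_nonneg[OF u]] by auto
  show ?thesis unfolding op_norm_on_def
  proof (rule cSup_eq_maximum)
    show "x \<le> ip_norm ip u" if "x \<in> (\<lambda>w. \<bar>ip u w\<bar>) ` {w \<in> W. ip_norm ip w \<le> 1}" for x
      using that bd by auto
    show "ip_norm ip u \<in> (\<lambda>w. \<bar>ip u w\<bar>) ` {w \<in> W. ip_norm ip w \<le> 1}"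
    proof (cases "u = 0")
      case True
      then show ?thesis using assms ip_norm_eq_0[OF u] ip_0_left[OF u] by force
    next
      case False
      define N where "N = ip_norm ip u"
      have N: "0 < N" using False ip_norm_nonneg[OF u] ip_norm_eq_0[OF u] by (simp add: N_def)
      have "(1 / N) *\<^sub>R u \<in> W" using assms subspace_scale by blast
      moreover have "ip_norm ip ((1 / N) *\<^sub>R u) = 1"
        using N by (simp add: ip_norm_scale[OF u]) (simp add: N_def)
      moreover have "ip u ((1 / N) *\<^sub>R u) = N"
        using N ip_norm_sq[OF u] subspace_scale[OF subspace_V u]
        by (simp add: ip_commute[OF u] ip_scale_left[OF u u] N_def power2_eq_square field_simps)
      ultimately show ?thesis using N unfolding N_def[symmetric]
        by (intro image_eqI[of _ _ "(1 / N) *\<^sub>R u"]) auto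
    qed
  qed
qed

lemma ip_dual_space:
  assumes "W \<subseteq> V" "u \<in> V"
  shows "ip u \<in> dual_space_on W (ip_norm ip)"
  unfolding dual_space_on_def bounded_linear_map_on_def
  using ip_linear_right[OF assms(2)] ip_Cauchy_Schwarz[OF assms(2)] assms(1)
  by (auto simp: linear_map_on_def subset_iff)

lemma ip_synthesis:
  assumes u: "u \<in> V" and I: "\<phi> ` I \<subseteq> V"
  shows "ip u (synthesis I \<phi> v) = (\<Sum>i\<in>I. Poly_Mapping.lookup v i * ip u (\<phi> i))"
proof -
  \<comment> \<open>Membership in \<open>V\<close> is proved together with the formula, since
    \<open>ip u\<close> is additive only on \<open>V\<close>.\<close>
  have "(\<Sum>i\<in>I. Poly_Mapping.lookup v i *\<^sub>R \<phi> i) \<in> V \<and>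
     ip u (\<Sum>i\<in>I. Poly_Mapping.lookup v i *\<^sub>R \<phi> i) = (\<Sum>i\<in>I. Poly_Mapping.lookup v i * ip u (\<phi> i))"
    using I
  proof (induction I rule: infinite_finite_induct)
    case (insert j I)
    then show ?case
      using ip_linear_right[OF u] subspace_add[OF subspace_V] subspace_scale[OF subspace_V]
      by (auto simp: linear_map_on_def)
  qed (auto simp: subspace_0[OF subspace_V] ip_0_left[OF u] ip_commute[OF u])
  then show ?thesis by (simp add: synthesis_def)
qed

end

section \<open>Coordinates, synthesis and the space l_2(I)\<close>

lemma lookup_scaleR_poly_mapping:
  "Poly_Mapping.lookup (r *\<^sub>R v) i = r *\<^sub>R Poly_Mapping.lookup v i"
proof -
  have "finite {i. r *\<^sub>R Poly_Mapping.lookup v i \<noteq> 0}"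
    by (rule finite_subset[OF _ finite_lookup[of v]]) auto
  then show ?thesis by (simp add: scaleR_poly_mapping_def)
qed

lemma synthesis_add: "synthesis I \<phi> (v + w) = synthesis I \<phi> v + synthesis I \<phi> w"
  by (simp add: synthesis_def lookup_add scaleR_add_left sum.distrib)

lemma synthesis_diff: "synthesis I \<phi> (v - w) = synthesis I \<phi> v - synthesis I \<phi> w"
  by (simp add: synthesis_def lookup_minus scaleR_diff_left sum_subtractf)

lemma synthesis_scaleR: "synthesis I \<phi> (r *\<^sub>R v) = r *\<^sub>R synthesis I \<phi> v"
  by (simp add: synthesis_def lookup_scaleR_poly_mapping scaleR_sum_right)

lemma synthesis_in_span: "synthesis I \<phi> v \<in> span (\<phi> ` I)"
  unfolding synthesis_def by (intro span_sum span_scale span_base imageI)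

lemma ell2_iff: "v \<in> ell2 I \<longleftrightarrow> (\<forall>i. i \<notin> I \<longrightarrow> Poly_Mapping.lookup v i = 0)"
  by (auto simp: ell2_def in_keys_iff)

lemma ell2_eqI:
  assumes "v \<in> ell2 I" "w \<in> ell2 I"
    and "\<And>i. i \<in> I \<Longrightarrow> Poly_Mapping.lookup v i = Poly_Mapping.lookup w i"
  shows "v = w"
proof (rule poly_mapping_eqI)
  fix i show "Poly_Mapping.lookup v i = Poly_Mapping.lookup w i"
    using assms by (cases "i \<in> I") (simp_all add: ell2_iff)
qed

lemma subspace_ell2: "subspace (ell2 I)"
  by (auto simp: subspace_def ell2_iff lookup_add lookup_scaleR_poly_mapping)

lemma subspace_ker_perp: "subspace (ker_perp I \<phi>)"
  using subspace_ell2[of I] unfolding subspace_def ker_perp_def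
  by (auto simp: lookup_add lookup_scaleR_poly_mapping distrib_right sum.distrib mult.assoc
      simp flip: sum_distrib_left)

lemma ell2_norm_sq:
  "(ell2_norm I v)\<^sup>2 = (\<Sum>i\<in>I. Poly_Mapping.lookup v i * Poly_Mapping.lookup v i)"
  by (simp add: ell2_norm_def L2_set_def sum_nonneg power2_eq_square)

lemma ell2_norm_nonneg: "0 \<le> ell2_norm I v"
  by (simp add: ell2_norm_def)

text \<open>The adjoint of \<open>synthesis\<close>. Cutting off outside \<open>I\<close> gives
  finite support for finite \<open>I\<close>, which \<open>Abs_poly_mapping\<close>
  requires.\<close>

definition analysis :: "('u \<Rightarrow> 'u \<Rightarrow> real) \<Rightarrow> 'i set \<Rightarrow> ('i \<Rightarrow> 'u) \<Rightarrow> 'u \<Rightarrow> ('i, real) poly_mapping" where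
  "analysis ip I \<phi> u = Abs_poly_mapping (\<lambda>i. if i \<in> I then ip u (\<phi> i) else 0)"

lemma lookup_analysis:
  "finite I \<Longrightarrow> Poly_Mapping.lookup (analysis ip I \<phi> u) i = (if i \<in> I then ip u (\<phi> i) else 0)"
  by (simp add: analysis_def)

lemma analysis_in_ell2: "finite I \<Longrightarrow> analysis ip I \<phi> u \<in> ell2 I"
  by (auto simp: ell2_def in_keys_iff lookup_analysis split: if_splits)

section \<open>The frame operator and the orthogonal complement of the kernel\<close>

context inner_product_on
begin

context
  fixes I :: "'i set" and \<phi> :: "'i \<Rightarrow> 'u" and c C :: real
  assumes frame: "is_frame (ip_norm ip) I \<phi> c C" and \<phi>_in: "\<phi> ` I \<subseteq> V"
begin

lemma finite_I: "finite I" and c_pos: "0 < c" and C_pos: "0 < C"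
  using frame by (auto simp: is_frame_def)

lemma span_subset: "span (\<phi> ` I) \<subseteq> V"
  using span_minimal[OF \<phi>_in subspace_V] .

lemma synthesis_in_V: "synthesis I \<phi> v \<in> V"
  using synthesis_in_span span_subset by blast

text \<open>The adjoint relation: the l_2 inner product on the left, the inner product of
  \<open>V\<close> on the right.\<close>

lemma ip_synthesis_analysis:
  assumes "u \<in> V"
  shows "(\<Sum>i\<in>I. Poly_Mapping.lookup (analysis ip I \<phi> u) i * Poly_Mapping.lookup v i)
    = ip u (synthesis I \<phi> v)"
  using finite_I by (simp add: ip_synthesis[OF assms \<phi>_in] lookup_analysis mult.commute)

text \<open>The frame inequalities at the functional \<open>ip u\<close>: the middle sum is the
  squared norm of the coefficients, and \<open>op_norm_on_ip\<close> evaluates the dual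
  norm.\<close>

lemma analysis_bounds:
  assumes "u \<in> span (\<phi> ` I)"
  shows "c * ip_norm ip u \<le> ell2_norm I (analysis ip I \<phi> u)"
    and "ell2_norm I (analysis ip I \<phi> u) \<le> C * ip_norm ip u"
proof -
  have u: "u \<in> V" using assms span_subset by blast
  have "ip u \<in> dual_space_on (span (\<phi> ` I)) (ip_norm ip)"
    by (rule ip_dual_space[OF span_subset u])
  moreover have "(\<Sum>i\<in>I. \<bar>ip u (\<phi> i)\<bar>\<^sup>2) = (ell2_norm I (analysis ip I \<phi> u))\<^sup>2"
    using finite_I by (simp add: ell2_norm_sq lookup_analysis) (simp add: power2_eq_square)
  ultimately have *: "(c * ip_norm ip u)\<^sup>2 \<le> (ell2_norm I (analysis ip I \<phi> u))\<^sup>2"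
    "(ell2_norm I (analysis ip I \<phi> u))\<^sup>2 \<le> (C * ip_norm ip u)\<^sup>2"
    using frame op_norm_on_ip[OF subspace_span span_subset assms]
    by (auto simp: is_frame_def power_mult_distrib)
  show "c * ip_norm ip u \<le> ell2_norm I (analysis ip I \<phi> u)"
    using power2_le_imp_le[OF *(1) ell2_norm_nonneg] .
  show "ell2_norm I (analysis ip I \<phi> u) \<le> C * ip_norm ip u"
    using power2_le_imp_le[OF *(2)] C_pos ip_norm_nonneg[OF u] by simp
qed

lemma ip_synthesis_le:
  assumes "u \<in> V"
  shows "ip u (synthesis I \<phi> v) \<le> ell2_norm I (analysis ip I \<phi> u) * ell2_norm I v"
  unfolding ip_synthesis_analysis[OF assms, symmetric] ell2_norm_def
  by (rule order_trans[OF _ L2_set_mult_ineq], rule sum_mono) (metis abs_ge_self abs_mult)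

text \<open>Testing \<open>ip_synthesis_le\<close> with the synthesised vector itself produces its
  norm on both sides. One factor cancels; if it is zero, the claim holds because the right-hand side
  is nonnegative.\<close>

lemma ip_norm_synthesis_le: "ip_norm ip (synthesis I \<phi> v) \<le> C * ell2_norm I v"
proof -
  define u where "u = synthesis I \<phi> v"
  have u: "u \<in> V" "u \<in> span (\<phi> ` I)" by (simp_all add: u_def synthesis_in_V synthesis_in_span)
  have "(ip_norm ip u)\<^sup>2 \<le> ell2_norm I (analysis ip I \<phi> u) * ell2_norm I v"
    using ip_synthesis_le[OF u(1), of v] ip_norm_sq[OF u(1)] by (simp add: u_def)
  also have "\<dots> \<le> C * ip_norm ip u * ell2_norm I v"
    using analysis_bounds(2)[OF u(2)] by (intro mult_right_mono ell2_norm_nonneg)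
  finally have "ip_norm ip u * ip_norm ip u \<le> ip_norm ip u * (C * ell2_norm I v)"
    by (simp add: power2_eq_square mult_ac)
  then show ?thesis
    using ip_norm_nonneg[OF u(1)] C_pos ell2_norm_nonneg[of I v] unfolding u_def[symmetric]
    by (cases "ip_norm ip u = 0") (auto simp: mult_le_cancel_left)
qed

text \<open>By adjointness the pairing with a kernel vector \<open>w\<close> is
  \<open>ip u (synthesis I \<phi> w)\<close>, that is, \<open>ip u 0\<close>.\<close>

lemma analysis_in_ker_perp:
  assumes "u \<in> V" shows "analysis ip I \<phi> u \<in> ker_perp I \<phi>"
  using ip_0_left[OF assms] subspace_0[OF subspace_V] assms
  by (auto simp: ker_perp_def analysis_in_ell2[OF finite_I] ip_synthesis_analysis[OF assms]
      ip_commute[OF assms])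

text \<open>The frame operator satisfies <u, F F^* u> = |F^* u|^2, which the lower frame bound keeps
  away from zero for nonzero u. Injectivity on the finite-dimensional span then gives
  surjectivity.\<close>

lemma frame_operator_surj:
  assumes "w \<in> span (\<phi> ` I)"
  obtains u where "u \<in> span (\<phi> ` I)" "synthesis I \<phi> (analysis ip I \<phi> u) = w"
proof -
  let ?T = "\<lambda>u. synthesis I \<phi> (analysis ip I \<phi> u)"
  have sub: "u \<in> V" if "u \<in> span (\<phi> ` I)" for u using that span_subset by blast
  have "?T ` span (\<phi> ` I) = span (\<phi> ` I)"
  proof (rule linear_map_on_span_surj)
    have add: "analysis ip I \<phi> (u + v) = analysis ip I \<phi> u + analysis ip I \<phi> v"
      if "u \<in> V" "v \<in> V" for u v
      using that \<phi>_in ip_linear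
      by (auto intro!: poly_mapping_eqI simp: lookup_add lookup_scaleR_poly_mapping
          lookup_analysis[OF finite_I] linear_map_on_def image_subset_iff)
    have scale: "analysis ip I \<phi> (r *\<^sub>R u) = r *\<^sub>R analysis ip I \<phi> u" if "u \<in> V" for u r
      using that \<phi>_in ip_linear
      by (auto intro!: poly_mapping_eqI simp: lookup_add lookup_scaleR_poly_mapping
          lookup_analysis[OF finite_I] linear_map_on_def image_subset_iff)
    show "linear_map_on (span (\<phi> ` I)) ?T"
      unfolding linear_map_on_def
    proof (intro conjI ballI allI)
      show "?T (u + v) = ?T u + ?T v" if "u \<in> span (\<phi> ` I)" "v \<in> span (\<phi> ` I)" for u v
        using add[OF sub sub, OF that] by (simp add: synthesis_add)
      show "?T (r *\<^sub>R u) = r *\<^sub>R ?T u" if "u \<in> span (\<phi> ` I)" for r u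
        using scale[OF sub, OF that] by (simp add: synthesis_scaleR)
    qed
    fix u assume u: "u \<in> span (\<phi> ` I)" "?T u = 0"
    have "(ell2_norm I (analysis ip I \<phi> u))\<^sup>2 = ip u (?T u)"
      using ip_synthesis_analysis[OF sub[OF u(1)], of "analysis ip I \<phi> u"]
      by (simp add: ell2_norm_sq)
    also have "\<dots> = 0"
      unfolding u(2) using ip_0_left[OF sub] ip_commute[OF sub subspace_0[OF subspace_V]] u(1) by simp
    finally have "c * ip_norm ip u \<le> 0" using analysis_bounds(1)[OF u(1)] by simp
    then show "u = 0"
      using c_pos ip_norm_nonneg[OF sub[OF u(1)]] ip_norm_eq_0[OF sub[OF u(1)]]
      by (simp add: mult_le_0_iff)
  qed (use finite_I synthesis_in_span in auto)
  then have "w \<in> ?T ` span (\<phi> ` I)" using assms by simp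
  then show thesis by (rule imageE) (rule that, simp_all)
qed

text \<open>For \<open>v\<close> in the complement choose \<open>u\<close> whose analysis has the
  same synthesis as \<open>v\<close>. The difference lies both in the kernel and in its complement,
  so it is orthogonal to itself.\<close>

lemma ker_perp_eq: "ker_perp I \<phi> = analysis ip I \<phi> ` span (\<phi> ` I)"
proof (intro equalityI subsetI)
  fix v assume v: "v \<in> ker_perp I \<phi>"
  then have v2: "v \<in> ell2 I" by (simp add: ker_perp_def)
  obtain u where u: "u \<in> span (\<phi> ` I)" "synthesis I \<phi> (analysis ip I \<phi> u) = synthesis I \<phi> v"
    using frame_operator_surj[OF synthesis_in_span] .
  define w where "w = v - analysis ip I \<phi> u"
  have w2: "w \<in> ell2 I"
    using subspace_diff[OF subspace_ell2 v2 analysis_in_ell2[OF finite_I]] by (simp add: w_def)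
  have "w \<in> ker_perp I \<phi>"
    using subspace_diff[OF subspace_ker_perp v analysis_in_ker_perp] u span_subset
    by (auto simp: w_def)
  moreover have "synthesis I \<phi> w = 0" using u by (simp add: w_def synthesis_diff)
  ultimately have "(\<Sum>i\<in>I. Poly_Mapping.lookup w i * Poly_Mapping.lookup w i) = 0"
    using w2 by (simp add: ker_perp_def)
  then have "\<forall>i\<in>I. Poly_Mapping.lookup w i = 0"
    using finite_I by (subst (asm) sum_nonneg_eq_0_iff) auto
  then have "v = analysis ip I \<phi> u"
    by (intro ell2_eqI[OF v2 analysis_in_ell2[OF finite_I]]) (simp add: w_def lookup_minus)
  then show "v \<in> analysis ip I \<phi> ` span (\<phi> ` I)" using u by blast
qed (use analysis_in_ker_perp span_subset in auto)

lemma ell2_norm_le_synthesis: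
  assumes "v \<in> ker_perp I \<phi>"
  shows "c * ell2_norm I v \<le> ip_norm ip (synthesis I \<phi> v)"
proof -
  obtain u where u: "u \<in> span (\<phi> ` I)" "v = analysis ip I \<phi> u"
    using assms unfolding ker_perp_eq by blast
  have uV: "u \<in> V" using u(1) span_subset by blast
  have n: "0 \<le> ip_norm ip (synthesis I \<phi> v)" by (rule ip_norm_nonneg[OF synthesis_in_V])
  have "(ell2_norm I v)\<^sup>2 = ip u (synthesis I \<phi> v)"
    using ip_synthesis_analysis[OF uV, of v] u(2) by (simp add: ell2_norm_sq)
  also have "\<dots> \<le> ip_norm ip u * ip_norm ip (synthesis I \<phi> v)"
    using ip_Cauchy_Schwarz[OF uV synthesis_in_V, of v] by linarith
  finally have "c * (ell2_norm I v)\<^sup>2 \<le> c * ip_norm ip u * ip_norm ip (synthesis I \<phi> v)"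
    using c_pos by (simp add: mult.assoc)
  \<comment> \<open>The lower frame bound enters here: \<open>v\<close> is the analysis of
    \<open>u\<close>, hence \<open>c * ip_norm ip u \<le> ell2_norm I v\<close>.\<close>
  also have "\<dots> \<le> ell2_norm I v * ip_norm ip (synthesis I \<phi> v)"
    using analysis_bounds(1)[OF u(1)] u n by (intro mult_right_mono) auto
  finally have "ell2_norm I v * (c * ell2_norm I v) \<le> ell2_norm I v * ip_norm ip (synthesis I \<phi> v)"
    by (simp add: power2_eq_square mult_ac)
  then show ?thesis
    using ell2_norm_nonneg[of I v] n by (cases "ell2_norm I v = 0") (auto simp: mult_le_cancel_left)
qed

text \<open>Restricting to the complement of the kernel loses nothing of the range. This later
  matches \<open>H_frame\<close>, which is defined through all of \<open>ell2 I\<close>.\<close>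

lemma synthesis_ker_perp: "synthesis I \<phi> ` ker_perp I \<phi> = span (\<phi> ` I)"
proof (intro equalityI subsetI)
  fix w assume "w \<in> span (\<phi> ` I)"
  then obtain u where "u \<in> span (\<phi> ` I)" "synthesis I \<phi> (analysis ip I \<phi> u) = w"
    by (rule frame_operator_surj)
  then show "w \<in> synthesis I \<phi> ` ker_perp I \<phi>" unfolding ker_perp_eq by blast
qed (auto simp: synthesis_in_span)

lemma synthesis_ell2: "synthesis I \<phi> ` ell2 I = span (\<phi> ` I)"
proof -
  have "ker_perp I \<phi> \<subseteq> ell2 I" by (auto simp: ker_perp_def)
  then have "synthesis I \<phi> ` ker_perp I \<phi> \<subseteq> synthesis I \<phi> ` ell2 I" by (rule image_mono)
  moreover have "synthesis I \<phi> ` ell2 I \<subseteq> span (\<phi> ` I)" using synthesis_in_span by (rule image_subsetI)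
  ultimately show ?thesis unfolding synthesis_ker_perp by (rule subset_antisym[rotated])
qed

end

end

section \<open>Operator norms and condition numbers\<close>

lemma hilbert_space_on_inner_product_on:
  "hilbert_space_on V ip \<Longrightarrow> inner_product_on V ip"
  unfolding hilbert_space_on_def by (rule inner_product_on.intro; elim conjE; simp)

lemma bounded_linear_map_on_nonneg_bound:
  assumes "bounded_linear_map_on V nV nW T" and "\<And>u. u \<in> V \<Longrightarrow> 0 \<le> nV u"
  obtains K where "0 \<le> K" "\<And>u. u \<in> V \<Longrightarrow> nW (T u) \<le> K * nV u"
proof -
  obtain K where K: "\<And>u. u \<in> V \<Longrightarrow> nW (T u) \<le> K * nV u"
    using assms(1) unfolding bounded_linear_map_on_def by blast
  \<comment> \<open>\<open>bounded_linear_map_on\<close> puts no sign on its constant; passing to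
    \<open>\<bar>K\<bar>\<close> allows inequalities to be multiplied.\<close>
  have "nW (T u) \<le> \<bar>K\<bar> * nV u" if "u \<in> V" for u
    using K[OF that] mult_right_mono[OF abs_ge_self[of K] assms(2)[OF that]] by linarith
  then show thesis using that[of "\<bar>K\<bar>"] by simp
qed

text \<open>The vector \<open>v\<close> shows that the supremum is taken over a nonempty set,
  without which a bound on its members says nothing about \<open>SUP\<close> on the reals.\<close>

lemma op_norm_on_le:
  assumes "v \<in> V" "nV v \<le> 1" "0 \<le> K" "\<And>u. u \<in> V \<Longrightarrow> nW (T u) \<le> K * nV u"
  shows "op_norm_on V nV nW T \<le> K"
  unfolding op_norm_on_def
proof (rule cSUP_least)
  fix u assume "u \<in> {u \<in> V. nV u \<le> 1}"
  then show "nW (T u) \<le> K"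
    using assms(4)[of u] mult_left_mono[OF _ assms(3), of "nV u" 1] by auto
qed (use assms in blast)

text \<open>A real \<open>SUP\<close> dominates its members only when they are bounded above;
  \<open>K\<close> provides that bound and \<open>v\<close> a nonnegative member.\<close>

lemma op_norm_on_nonneg:
  assumes "v \<in> V" "nV v \<le> 1" "0 \<le> nW (T v)" "\<And>u. u \<in> V \<Longrightarrow> nW (T u) \<le> K * nV u" "0 \<le> K"
  shows "0 \<le> op_norm_on V nV nW T"
  unfolding op_norm_on_def
proof (rule order_trans[OF assms(3)], rule cSUP_upper)
  show "bdd_above ((\<lambda>u. nW (T u)) ` {u \<in> V. nV u \<le> 1})"
  proof (rule bdd_aboveI2)
    fix u assume "u \<in> {u \<in> V. nV u \<le> 1}"
    then show "nW (T u) \<le> K"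
      using assms(4)[of u] mult_left_mono[OF _ assms(5), of "nV u" 1] by auto
  qed
qed (use assms in blast)

lemma linear_map_on_inv_into:
  assumes V: "subspace V" and T: "linear_map_on V T" and bij: "bij_betw T V W"
  shows "linear_map_on W (inv_into V T)"
proof -
  have inj: "inj_on T V" and W: "W = T ` V" using bij by (auto simp: bij_betw_def)
  show ?thesis
    unfolding linear_map_on_def W ball_simps image_iff
  proof (intro conjI ballI allI)
    show "inv_into V T (T u + T v) = inv_into V T (T u) + inv_into V T (T v)"
      if "u \<in> V" "v \<in> V" for u v
    proof -
      have "T u + T v = T (u + v)" using T that by (simp add: linear_map_on_def)
      then show ?thesis using that subspace_add[OF V that] by (simp add: inv_into_f_f[OF inj])
    qed
    show "inv_into V T (r *\<^sub>R T u) = r *\<^sub>R inv_into V T (T u)" if "u \<in> V" for r u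
    proof -
      have "r *\<^sub>R T u = T (r *\<^sub>R u)" using T that by (simp add: linear_map_on_def)
      then show ?thesis using that subspace_scale[OF V that] by (simp add: inv_into_f_f[OF inj])
    qed
  qed
qed

text \<open>The operator norm is at most \<open>K * C\<close> and that of the inverse at most
  \<open>L / c\<close>: each combines a bound for \<open>D\<close> with the matching frame bound for
  \<open>synthesis\<close>.\<close>

lemma (in inner_product_on) well_conditioned_on_ker_perp:
  fixes D :: "'u \<Rightarrow> 'h::real_normed_vector" and \<phi> :: "'i \<Rightarrow> 'u"
  assumes frame: "is_frame (ip_norm ip) I \<phi> c C" and \<phi>: "\<phi> ` I \<subseteq> V"
    and D: "linear_map_on V D" "inj_on D V"
    and K: "0 \<le> K" "\<And>u. u \<in> V \<Longrightarrow> norm (D u) \<le> K * ip_norm ip u"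
    and L: "0 \<le> L" "\<And>u. u \<in> V \<Longrightarrow> ip_norm ip u \<le> L * norm (D u)"
  shows "isomorphism_on (ker_perp I \<phi>) (ell2_norm I) (H_frame D I \<phi>) norm (D \<circ> synthesis I \<phi>)"
    and "condition_number_on (ker_perp I \<phi>) (ell2_norm I) (H_frame D I \<phi>) norm (D \<circ> synthesis I \<phi>)
      \<le> K * L * (C / c)"
proof -
  let ?N = "ker_perp I \<phi>" and ?T = "D \<circ> synthesis I \<phi>" and ?H = "H_frame D I \<phi>"
  have c: "0 < c" "0 < C" using c_pos[OF frame \<phi>] C_pos[OF frame \<phi>] by auto
  have synV: "synthesis I \<phi> v \<in> V" for v by (rule synthesis_in_V[OF frame \<phi>])
  have up: "norm (?T v) \<le> (K * C) * ell2_norm I v" for v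
    using K(2)[OF synV, of v] mult_left_mono[OF ip_norm_synthesis_le[OF frame \<phi>, of v] K(1)]
    by (simp add: mult_ac)
  have low: "ell2_norm I v \<le> (L / c) * norm (?T v)" if "v \<in> ?N" for v
    using ell2_norm_le_synthesis[OF frame \<phi> that] L(2)[OF synV, of v] c by (simp add: field_simps)
  \<comment> \<open>Injectivity is the lower bound applied to \<open>v - w\<close>, which stays in
    the complement because that is a subspace.\<close>
  have "synthesis I \<phi> v - synthesis I \<phi> w = 0 \<Longrightarrow> v = w" if "v \<in> ?N" "w \<in> ?N" for v w
  proof -
    assume "synthesis I \<phi> v - synthesis I \<phi> w = 0"
    then have "synthesis I \<phi> (v - w) = 0" by (simp add: synthesis_diff)
    moreover have d: "v - w \<in> ?N" by (rule subspace_diff[OF subspace_ker_perp that])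
    ultimately have "c * ell2_norm I (v - w) \<le> 0"
      using ell2_norm_le_synthesis[OF frame \<phi> d] ip_norm_eq_0[OF subspace_0[OF subspace_V]]
      by simp
    then have "ell2_norm I (v - w) = 0"
      using c ell2_norm_nonneg[of I "v - w"] by (simp add: mult_le_0_iff)
    then have "\<forall>i\<in>I. Poly_Mapping.lookup v i = Poly_Mapping.lookup w i"
      using finite_I[OF frame \<phi>] by (simp add: ell2_norm_def L2_set_eq_0_iff lookup_minus)
    then show "v = w" using that by (intro ell2_eqI[of v I w]) (auto simp: ker_perp_def)
  qed
  then have inj: "inj_on ?T ?N"
    using synV by (intro comp_inj_on inj_on_subset[OF D(2)] inj_onI image_subsetI) auto
  have img: "?T ` ?N = ?H"
    unfolding H_frame_def image_comp[symmetric] synthesis_ker_perp[OF frame \<phi>] synthesis_ell2[OF frame \<phi>] ..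
  have bij: "bij_betw ?T ?N ?H" using inj img by (simp add: bij_betw_def)
  have lin: "linear_map_on ?N ?T"
    using D(1) synV by (auto simp: linear_map_on_def synthesis_add synthesis_scaleR)
  have inv: "ell2_norm I (inv_into ?N ?T h) \<le> (L / c) * norm h" if "h \<in> ?H" for h
  proof -
    from that obtain v where v: "h = ?T v" "v \<in> ?N" unfolding img[symmetric] by (rule imageE)
    have "inv_into ?N ?T h = v" unfolding v(1) by (rule inv_into_f_f[OF inj v(2)])
    then show ?thesis using low[OF v(2)] v(1) by simp
  qed
  show "isomorphism_on ?N (ell2_norm I) ?H norm ?T"
    unfolding isomorphism_on_def bounded_linear_map_on_def
    using bij lin up inv linear_map_on_inv_into[OF subspace_ker_perp lin bij] by blast
  have N0: "0 \<in> ?N" by (rule subspace_0[OF subspace_ker_perp])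
  have T0: "?T 0 = 0" using lin N0 unfolding linear_map_on_def by (metis scaleR_zero_left)
  have H0: "0 \<in> ?H" unfolding img[symmetric] by (rule image_eqI[where x = 0]) (rule T0[symmetric], rule N0)
  have "op_norm_on ?N (ell2_norm I) norm ?T \<le> K * C"
    by (rule op_norm_on_le[OF N0]) (use up K c in \<open>auto simp: ell2_norm_def L2_set_def\<close>)
  moreover have "op_norm_on ?H norm (ell2_norm I) (inv_into ?N ?T) \<le> L / c"
    by (rule op_norm_on_le[OF H0]) (use inv L c in auto)
  \<comment> \<open>Multiplying the two upper bounds requires the second factor to be
    nonnegative.\<close>
  moreover have "0 \<le> op_norm_on ?H norm (ell2_norm I) (inv_into ?N ?T)"
    by (rule op_norm_on_nonneg[where v = 0 and K = "L / c"])
      (use H0 inv L c in \<open>auto simp: ell2_norm_nonneg\<close>)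
  ultimately have "condition_number_on ?N (ell2_norm I) ?H norm ?T \<le> (K * C) * (L / c)"
    unfolding condition_number_on_def using K c by (intro mult_mono) auto
  then show "condition_number_on ?N (ell2_norm I) ?H norm ?T \<le> K * L * (C / c)"
    by (simp add: mult_ac)
qed

text \<open>\<open>K\<close> and \<open>L\<close> belong to \<open>D\<close> alone and
  \<open>M\<close> bounds all quotients \<open>C J / c J\<close>, so \<open>K * L * M\<close> serves
  every \<open>J\<close>.\<close>

lemma uniformly_well_conditioned_frames:
  fixes D :: "'u::real_vector \<Rightarrow> 'h::real_normed_vector"
  assumes H: "hilbert_space_on U ip"
    and iso: "isomorphism_on U (ip_norm ip) (D ` U) norm D"
    and fr: "uniform_frame_family U (ip_norm ip) I \<Phi> c C"
  shows "uniformly_well_conditioned D I \<Phi>"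
proof -
  interpret inner_product_on U ip by (rule hilbert_space_on_inner_product_on[OF H])
  have D: "inj_on D U" and bD: "bounded_linear_map_on U (ip_norm ip) norm D"
    and bI: "bounded_linear_map_on (D ` U) norm (ip_norm ip) (inv_into U D)"
    using iso unfolding isomorphism_on_def bij_betw_def by simp_all
  have lD: "linear_map_on U D" using bD by (simp add: bounded_linear_map_on_def)
  obtain K where K: "0 \<le> K" "\<And>u. u \<in> U \<Longrightarrow> norm (D u) \<le> K * ip_norm ip u"
    using bounded_linear_map_on_nonneg_bound[OF bD ip_norm_nonneg] by blast
  obtain L where L: "0 \<le> L" "\<And>h. h \<in> D ` U \<Longrightarrow> ip_norm ip (inv_into U D h) \<le> L * norm h"
    using bounded_linear_map_on_nonneg_bound[OF bI norm_ge_zero] by blast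
  have L': "ip_norm ip u \<le> L * norm (D u)" if "u \<in> U" for u
    using L(2)[of "D u"] that inv_into_f_f[OF D] by simp
  obtain M where M: "\<And>J. C J / c J \<le> M"
    using fr by (auto simp: uniform_frame_family_def bdd_above_def)
  have fJ: "is_frame (ip_norm ip) (I J) (\<Phi> J) (c J) (C J)" "\<Phi> J ` I J \<subseteq> U" for J
    using fr by (auto simp: uniform_frame_family_def)
  have "K * L * (C J / c J) \<le> K * L * M" for J
    using M K(1) L(1) by (intro mult_left_mono) auto
  then show ?thesis
    unfolding uniformly_well_conditioned_def
    using well_conditioned_on_ker_perp[OF fJ lD D K L(1) L'] by (meson order_trans)
qed

section \<open>Smooth functions\<close>

lemma pderiv_at_eq: "(f has_derivative f') (at x) \<Longrightarrow> pderiv_at i f x = f' (axis i 1)"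
  by (simp add: pderiv_at_def frechet_derivative_at[symmetric])

text \<open>The recursion for \<open>C_k\<close> does not repeat lower orders, so monotonicity needs
  an induction whose base is that differentiability implies continuity. The product and chain rules
  use it for the factors left undifferentiated.\<close>

lemma C_k_Suc_imp: "C_k (Suc k) f \<Longrightarrow> C_k k f"
proof (induction k arbitrary: f)
  case 0
  then show ?case
    by (auto intro!: continuous_at_imp_continuous_on differentiable_imp_continuous_within)
next
  case (Suc k)
  have "\<forall>x. f differentiable (at x)" "\<forall>i. C_k (Suc k) (pderiv_at i f)"
    using Suc.prems by (subst (asm) C_k.simps(2), blast)+
  then show ?case using Suc.IH by (subst C_k.simps(2)) blast
qed

lemma C_k_const: "C_k k (\<lambda>x. c)"
proof (induction k arbitrary: c)
  case (Suc k)
  have "pderiv_at i (\<lambda>x::real^'a. c) = (\<lambda>x. 0)" for i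
    using pderiv_at_eq[OF has_derivative_const] by fastforce
  with Suc show ?case by simp
qed simp

lemma C_k_coord: "C_k k (\<lambda>x::real^'d. x $ i)"
proof (cases k)
  case (Suc m)
  have d: "((\<lambda>x::real^'d. x $ i) has_derivative (\<lambda>x. x $ i)) (at x)" for x
    by (rule bounded_linear.has_derivative[OF bounded_linear_vec_nth has_derivative_ident])
  have "pderiv_at j (\<lambda>x::real^'d. x $ i) = (\<lambda>x. axis j 1 $ i)" for j
    using pderiv_at_eq[OF d] by blast
  then show ?thesis using Suc d by (auto simp: differentiable_def C_k_const)
qed (simp add: continuous_on_component)

lemma C_k_add: "C_k k f \<Longrightarrow> C_k k g \<Longrightarrow> C_k k (\<lambda>x. f x + g x)"
proof (induction k arbitrary: f g)
  case (Suc k)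
  have d: "f differentiable (at x)" "g differentiable (at x)" for x using Suc.prems by auto
  have "pderiv_at i (\<lambda>x. f x + g x) = (\<lambda>x. pderiv_at i f x + pderiv_at i g x)" for i
    using pderiv_at_eq[OF has_derivative_add[OF d[unfolded frechet_derivative_works]]]
    by (auto simp: pderiv_at_def)
  with Suc d show ?case by simp
qed (auto intro: continuous_on_add)

lemma C_k_mult: "C_k k f \<Longrightarrow> C_k k g \<Longrightarrow> C_k k (\<lambda>x. f x * g x)"
proof (induction k arbitrary: f g)
  case (Suc k)
  have d: "f differentiable (at x)" "g differentiable (at x)" for x using Suc.prems by auto
  have "pderiv_at i (\<lambda>x. f x * g x) = (\<lambda>x. f x * pderiv_at i g x + pderiv_at i f x * g x)" for i
    using pderiv_at_eq[OF has_derivative_mult[OF d[unfolded frechet_derivative_works]]]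
    by (auto simp: pderiv_at_def)
  moreover have "C_k k (\<lambda>x. f x * pderiv_at i g x + pderiv_at i f x * g x)" for i
    using Suc.prems C_k_Suc_imp[OF Suc.prems(1)] C_k_Suc_imp[OF Suc.prems(2)]
    by (intro C_k_add Suc.IH) auto
  ultimately show ?case using d by simp
qed (auto intro: continuous_on_mult)

lemma C_k_prod: "finite S \<Longrightarrow> (\<And>i. i \<in> S \<Longrightarrow> C_k k (f i)) \<Longrightarrow> C_k k (\<lambda>x. \<Prod>i\<in>S. f i x)"
  by (induction S rule: finite_induct) (auto simp: C_k_const C_k_mult)

text \<open>The polynomial parameter makes this class closed under differentiation, so that smoothness of
  $e^{-1/t}$, the case $p = 1$, is a single induction.\<close>

definition flat :: "real poly \<Rightarrow> real \<Rightarrow> real" where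
  "flat p t = (if 0 < t then poly p (1 / t) * exp (- (1 / t)) else 0)"

lemma poly_div_exp_tendsto_0: "((\<lambda>x. poly p x * exp (- x)) \<longlongrightarrow> (0::real)) at_top"
proof -
  have "((\<lambda>x. \<Sum>i\<le>degree p. coeff p i * (x ^ i / exp x)) \<longlongrightarrow> (\<Sum>i\<le>degree p. coeff p i * 0)) at_top"
    by (intro tendsto_sum tendsto_mult tendsto_const tendsto_power_div_exp_0)
  then show ?thesis
    by (simp add: poly_altdef sum_distrib_right exp_minus divide_inverse mult.assoc)
qed

text \<open>For t > 0 the derivative of p(1/t) exp(-1/t) is t^(-2) (p - p')(1/t) exp(-1/t), and
  \<open>[:0, 0, 1:]\<close> is the square that becomes t^(-2). Only t = 0 needs a limit
  argument.\<close>

lemma has_real_derivative_flat: "(flat p has_real_derivative flat ([:0, 0, 1:] * (p - pderiv p)) t) (at t)"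
proof -
  consider "t < 0" | "t = 0" | "0 < t" by linarith
  then show ?thesis
  proof cases
    case 1
    have "((\<lambda>t. 0) has_real_derivative 0) (at t)" by simp
    then have "(flat p has_real_derivative 0) (at t)"
      by (rule DERIV_cong_ev[THEN iffD1, rotated 3])
        (use 1 eventually_nhds_in_open[of "{..<0}" t] in \<open>auto simp: flat_def elim: eventually_mono\<close>)
    then show ?thesis using 1 by (simp add: flat_def)
  next
    case 3
    have "((\<lambda>t. poly p (1 / t) * exp (- (1 / t))) has_real_derivative
        flat ([:0, 0, 1:] * (p - pderiv p)) t) (at t)"
      using 3 by (auto intro!: derivative_eq_intros DERIV_chain2[OF poly_DERIV]
          simp: flat_def power2_eq_square algebra_simps)
    then show ?thesis
      by (rule DERIV_cong_ev[THEN iffD1, rotated 3])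
        (use 3 eventually_nhds_in_open[of "{0<..}" t] in \<open>auto simp: flat_def elim: eventually_mono\<close>)
  next
    case 2
    \<comment> \<open>\<open>pCons 0 p\<close> is x p(x); at x = 1/h it supplies the factor 1/h of
      the difference quotient at 0.\<close>
    have "((\<lambda>h. poly (pCons 0 p) (inverse h) * exp (- inverse h)) \<longlongrightarrow> 0) (at_right 0)"
      by (rule filterlim_compose[OF poly_div_exp_tendsto_0 filterlim_inverse_at_top_right])
    then have "((\<lambda>h. flat p h / h) \<longlongrightarrow> 0) (at_right 0)"
      by (rule filterlim_cong[THEN iffD1, rotated -1, OF _ refl refl])
        (auto simp: flat_def eventually_at_right_less field_simps intro: eventually_mono[OF eventually_at_right_less])
    moreover have "((\<lambda>h. flat p h / h) \<longlongrightarrow> 0) (at_left 0)"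
      by (rule tendsto_eventually) (auto simp: eventually_at_left_field flat_def intro!: exI[of _ "-1"])
    ultimately have "((\<lambda>h. flat p h / h) \<longlongrightarrow> 0) (at 0)" by (simp add: filterlim_split_at_real)
    then show ?thesis using 2 by (simp add: DERIV_def flat_def)
  qed
qed

lemma C_k_flat: "C_k k f \<Longrightarrow> C_k k (\<lambda>x. flat p (f x))"
proof (induction k arbitrary: f p)
  case 0
  have "continuous_on UNIV (flat p)"
    by (intro continuous_at_imp_continuous_on ballI DERIV_isCont[OF has_real_derivative_flat])
  then show ?case using 0 continuous_on_compose2[of UNIV "flat p" UNIV f] by simp
next
  case (Suc k)
  let ?q = "[:0, 0, 1:] * (p - pderiv p)"
  have fd: "(f has_derivative frechet_derivative f (at x)) (at x)" for x
    using Suc.prems frechet_derivative_works by auto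
  note d = DERIV_compose_FDERIV[OF has_real_derivative_flat fd]
  have "pderiv_at i (\<lambda>x. flat p (f x)) = (\<lambda>x. pderiv_at i f x * flat ?q (f x))" for i
    using pderiv_at_eq[OF d] unfolding pderiv_at_def by blast
  moreover have "C_k k (\<lambda>x. pderiv_at i f x * flat ?q (f x))" for i
    using Suc.prems C_k_Suc_imp[OF Suc.prems] by (intro C_k_mult Suc.IH) auto
  moreover have "(\<lambda>x. flat p (f x)) differentiable (at x)" for x
    using d unfolding differentiable_def by blast
  ultimately show ?case by (simp only: C_k.simps simp_thms)
qed

section \<open>Test functions and their closure properties\<close>

lemma test_functions_continuous: "\<phi> \<in> test_functions \<Omega> \<Longrightarrow> continuous_on UNIV \<phi>"
  unfolding test_functions_def using C_k.simps(1) by blast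

lemma test_functions_differentiable: "\<phi> \<in> test_functions \<Omega> \<Longrightarrow> \<phi> differentiable (at x)"
  unfolding test_functions_def using C_k.simps(2) by blast

text \<open>Any compact set outside which \<open>f\<close> vanishes may stand in for the support,
  whose closure is then a closed subset of it.\<close>

lemma test_functions_supportI:
  assumes "\<And>k. C_k k f" "compact K" "K \<subseteq> \<Omega>" "\<And>x. x \<notin> K \<Longrightarrow> f x = 0"
  shows "f \<in> test_functions \<Omega>"
proof -
  have "closure {x. f x \<noteq> 0} \<subseteq> K"
    using assms by (intro closure_minimal) (auto simp: compact_imp_closed)
  then show ?thesis
    using assms compact_Int_closed[OF assms(2), of "closure {x. f x \<noteq> 0}"]
    by (auto simp: test_functions_def Int_absorb1)
qed

lemma test_functions_support:
  assumes "\<phi> \<in> test_functions \<Omega>"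
  obtains K where "compact K" "K \<subseteq> \<Omega>" "\<And>x. x \<notin> K \<Longrightarrow> \<phi> x = 0"
proof (rule that[of "closure {x. \<phi> x \<noteq> 0}"])
  show "\<phi> x = 0" if "x \<notin> closure {x. \<phi> x \<noteq> 0}" for x
    using that closure_subset[of "{x. \<phi> x \<noteq> 0}"] by blast
qed (use assms in \<open>simp_all add: test_functions_def\<close>)

lemma test_functions_add:
  assumes "\<phi> \<in> test_functions \<Omega>" "\<psi> \<in> test_functions \<Omega>"
  shows "(\<lambda>x. \<phi> x + \<psi> x) \<in> test_functions \<Omega>"
proof -
  obtain K where K: "compact K" "K \<subseteq> \<Omega>" "\<And>x. x \<notin> K \<Longrightarrow> \<phi> x = 0"
    by (rule test_functions_support[OF assms(1)]) (rule that)
  obtain L where L: "compact L" "L \<subseteq> \<Omega>" "\<And>x. x \<notin> L \<Longrightarrow> \<psi> x = 0"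
    by (rule test_functions_support[OF assms(2)]) (rule that)
  show ?thesis
    by (rule test_functions_supportI[of _ "K \<union> L"])
      (use assms K L in \<open>auto simp: test_functions_def intro: C_k_add\<close>)
qed

lemma test_functions_mult:
  assumes "\<phi> \<in> test_functions \<Omega>" "\<And>k. C_k k f"
  shows "(\<lambda>x. f x * \<phi> x) \<in> test_functions \<Omega>"
proof -
  obtain K where K: "compact K" "K \<subseteq> \<Omega>" "\<And>x. x \<notin> K \<Longrightarrow> \<phi> x = 0"
    by (rule test_functions_support[OF assms(1)]) (rule that)
  show ?thesis
    by (rule test_functions_supportI[of _ K])
      (use assms K in \<open>auto simp: test_functions_def intro: C_k_mult\<close>)
qed

lemma test_functions_scale: "\<phi> \<in> test_functions \<Omega> \<Longrightarrow> (\<lambda>x. c * \<phi> x) \<in> test_functions \<Omega>"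
  by (rule test_functions_mult[OF _ C_k_const])

lemma zero_test_function: "(\<lambda>x. 0) \<in> test_functions \<Omega>"
  by (rule test_functions_supportI[of _ "{}"]) (auto simp: C_k_const)

text \<open>The complement of a compact set is open, so vanishing there forces the derivative to
  vanish there too.\<close>

lemma pderiv_test_function:
  assumes "\<phi> \<in> test_functions \<Omega>"
  shows "pderiv_at i \<phi> \<in> test_functions \<Omega>"
proof -
  obtain K where K: "compact K" "K \<subseteq> \<Omega>" "\<And>x. x \<notin> K \<Longrightarrow> \<phi> x = 0"
    by (rule test_functions_support[OF assms]) (rule that)
  have "pderiv_at i \<phi> x = 0" if "x \<notin> K" for x
  proof -
    have "((\<lambda>x. 0) has_derivative (\<lambda>h. 0)) (at x)" by simp
    then have "(\<phi> has_derivative (\<lambda>h. 0)) (at x)"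
      by (rule has_derivative_transform_within_open[of _ _ _ _ "- K"])
        (use that K in \<open>auto simp: compact_imp_closed open_Compl\<close>)
    then show ?thesis by (rule pderiv_at_eq)
  qed
  moreover have "C_k k (pderiv_at i \<phi>)" for k
  proof -
    have "C_k (Suc k) \<phi>" using assms unfolding test_functions_def by blast
    then show ?thesis by simp
  qed
  ultimately show ?thesis using K by (intro test_functions_supportI[of _ K]) auto
qed

lemma test_functions_integrable:
  assumes "\<phi> \<in> test_functions \<Omega>"
  shows "integrable lborel \<phi>"
proof -
  obtain K where K: "compact K" "\<And>x. x \<notin> K \<Longrightarrow> \<phi> x = 0"
    by (rule test_functions_support[OF assms]) (rule that)
  have "integrable lborel (\<lambda>x. indicator K x *\<^sub>R \<phi> x)"
    by (intro borel_integrable_compact K continuous_on_subset[OF test_functions_continuous[OF assms]]) auto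
  also have "(\<lambda>x. indicator K x *\<^sub>R \<phi> x) = \<phi>" using K(2) by (auto simp: fun_eq_iff indicator_def)
  finally show ?thesis .
qed

lemma test_functions_borel: "\<phi> \<in> test_functions \<Omega> \<Longrightarrow> \<phi> \<in> borel_measurable borel"
  by (intro borel_measurable_continuous_onI test_functions_continuous)

lemma test_functions_square_integrable:
  assumes "\<phi> \<in> test_functions \<Omega>"
  shows "square_integrable \<phi>"
proof -
  have "integrable lborel (\<lambda>x. \<phi> x * \<phi> x)"
    by (rule test_functions_integrable[OF test_functions_mult[OF assms]])
      (use assms in \<open>auto simp: test_functions_def\<close>)
  then have "integrable lebesgue (\<lambda>x. \<phi> x * \<phi> x)"
    by (subst integrable_completion) auto
  moreover have "\<phi> \<in> borel_measurable lebesgue"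
    using test_functions_borel[OF assms] by (intro measurable_completion) simp
  ultimately show ?thesis by (simp add: square_integrable_def power2_eq_square)
qed

text \<open>Smooth approximations of the indicator of the open box \<open>box a b\<close>. Since
  \<open>flat 1 t\<close> is exp(-1/t) for t > 0, each factor tends to 1 inside the box as
  \<open>n\<close> grows, while outside some factor is 0. \<open>Suc n\<close> keeps the scale
  positive.\<close>

definition box_bump :: "real ^ 'd \<Rightarrow> real ^ 'd \<Rightarrow> nat \<Rightarrow> real ^ 'd \<Rightarrow> real" where
  "box_bump a b n x =
     (\<Prod>i\<in>UNIV. flat 1 (real (Suc n) * (x $ i - a $ i)) * flat 1 (real (Suc n) * (b $ i - x $ i)))"

lemma C_k_box_bump: "C_k k (box_bump a b n)"
proof -
  have *: "C_k k (\<lambda>x. x $ i - a $ i)" "C_k k (\<lambda>x. b $ i - x $ i)" for i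
    using C_k_add[OF C_k_coord C_k_const[of k "- a $ i"], of i]
      C_k_add[OF C_k_const[of k "b $ i"] C_k_mult[OF C_k_const[of k "-1"] C_k_coord[of k i]]] by simp_all
  show ?thesis
    unfolding box_bump_def by (intro C_k_prod C_k_mult C_k_flat C_k_const * finite)
qed

lemma flat_1_bounds: "0 \<le> flat 1 t" "flat 1 t \<le> 1"
  by (auto simp: flat_def)

lemma box_bump_bounds: "0 \<le> box_bump a b n x" "box_bump a b n x \<le> 1"
  unfolding box_bump_def
  by (intro prod_nonneg ballI mult_nonneg_nonneg flat_1_bounds)
    (intro prod_le_1 conjI mult_nonneg_nonneg mult_le_one flat_1_bounds)

lemma box_bump_outside: "x \<notin> box a b \<Longrightarrow> box_bump a b n x = 0"
proof -
  assume "x \<notin> box a b"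
  then obtain i where "\<not> 0 < x $ i - a $ i \<or> \<not> 0 < b $ i - x $ i" by (auto simp: mem_box_cart)
  then have "flat 1 (real (Suc n) * (x $ i - a $ i)) * flat 1 (real (Suc n) * (b $ i - x $ i)) = 0"
    by (auto simp: flat_def zero_less_mult_iff simp del: of_nat_Suc)
  then show ?thesis unfolding box_bump_def by (intro prod_zero) auto
qed

lemma box_bump_test_function:
  assumes "cbox a b \<subseteq> \<Omega>" shows "box_bump a b n \<in> test_functions \<Omega>"
  by (rule test_functions_supportI[of _ "cbox a b"])
    (use assms box_subset_cbox[of a b] in \<open>auto simp: C_k_box_bump intro!: box_bump_outside\<close>)

lemma flat_1_tendsto: "0 < t \<Longrightarrow> (\<lambda>n. flat 1 (real (Suc n) * t)) \<longlonglongrightarrow> 1"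
proof -
  assume t: "0 < t"
  have "(\<lambda>n. exp (- (1 / t * inverse (real (Suc n))))) \<longlonglongrightarrow> exp (- (1 / t * 0))"
    by (intro tendsto_intros LIMSEQ_inverse_real_of_nat)
  moreover have "flat 1 (real (Suc n) * t) = exp (- (1 / t * inverse (real (Suc n))))" for n
    using t by (simp add: flat_def divide_inverse mult.commute del: of_nat_Suc)
  ultimately show ?thesis by simp
qed

lemma box_bump_tendsto: "(\<lambda>n. box_bump a b n x) \<longlonglongrightarrow> indicator (box a b) x"
proof (cases "x \<in> box a b")
  case True
  have "(\<lambda>n. box_bump a b n x) \<longlonglongrightarrow> (\<Prod>i\<in>(UNIV::'a set). 1 * 1)"
    unfolding box_bump_def using True
    by (intro tendsto_prod tendsto_mult flat_1_tendsto) (auto simp: mem_box_cart)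
  then show ?thesis using True by simp
qed (simp add: box_bump_outside)

section \<open>Integration by parts and the fundamental lemma\<close>

lemma integral_lborel_translation:
  fixes f :: "'a::euclidean_space \<Rightarrow> real"
  assumes "f \<in> borel_measurable borel"
  shows "(\<integral>x. f (c + x) \<partial>lborel) = (\<integral>x. f x \<partial>lborel)"
proof -
  have "(\<integral>x. f x \<partial>lborel) = (\<integral>x. f x \<partial>distr lborel borel ((+) c))"
    by (simp only: lborel_distr_plus)
  also have "\<dots> = (\<integral>x. f (c + x) \<partial>lborel)"
    using assms by (intro integral_distr) auto
  finally show ?thesis ..
qed

lemma integrable_lborel_translation:
  fixes f :: "'a::euclidean_space \<Rightarrow> real"
  assumes "integrable lborel f"
  shows "integrable lborel (\<lambda>x. f (c + x))"
  by (rule integrable_distr[of "(+) c" lborel borel f]) (simp_all add: lborel_distr_plus assms)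

text \<open>Reduces a partial derivative to one variable, for the mean value theorem. The order
  \<open>t *\<^sub>R axis i 1 + x\<close> matches the translation lemmas.\<close>

lemma pderiv_at_has_real_derivative:
  assumes "\<And>x. f differentiable (at x)"
  shows "((\<lambda>t. f (t *\<^sub>R axis i 1 + x)) has_real_derivative pderiv_at i f (t *\<^sub>R axis i 1 + x)) (at t)"
proof -
  let ?y = "t *\<^sub>R axis i 1 + x"
  have f: "(f has_derivative frechet_derivative f (at ?y)) (at ?y)"
    using assms frechet_derivative_works by blast
  have "((\<lambda>t. t *\<^sub>R axis i 1 + x) has_derivative (\<lambda>h. h *\<^sub>R axis i 1)) (at t)"
    by (auto intro!: derivative_eq_intros)
  from has_derivative_compose[OF this f]
  have "((\<lambda>t. f (t *\<^sub>R axis i 1 + x)) has_derivative (\<lambda>h. frechet_derivative f (at ?y) (h *\<^sub>R axis i 1))) (at t)" .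
  moreover have "frechet_derivative f (at ?y) (h *\<^sub>R axis i 1) = pderiv_at i f ?y * h" for h
    using linear_scale[OF linear_frechet_derivative[OF assms[of ?y]], of h] by (simp add: pderiv_at_def)
  ultimately show ?thesis by (simp add: has_field_derivative_def)
qed

text \<open>The difference quotients of \<open>\<phi>\<close> in direction \<open>i\<close> have integral zero by translation invariance
  and converge to the partial derivative.\<close>

lemma integral_pderiv_test_function:
  fixes \<phi> :: "real ^ 'd \<Rightarrow> real"
  assumes \<phi>: "\<phi> \<in> test_functions \<Omega>"
  shows "(\<integral>x. pderiv_at i \<phi> x \<partial>lborel) = 0"
proof -
  let ?\<psi> = "pderiv_at i \<phi>" and ?e = "axis i 1 :: real ^ 'd"
  define h where "h n = inverse (real (Suc n))" for n
  have h: "0 < h n" "h n \<le> 1" for n by (auto simp: h_def field_simps)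
  define s where "s n x = (\<phi> (h n *\<^sub>R ?e + x) - \<phi> x) / h n" for n x
  have \<psi>: "?\<psi> \<in> test_functions \<Omega>" by (rule pderiv_test_function[OF \<phi>])
  obtain K where K: "compact K" "K \<subseteq> \<Omega>" "\<And>x. x \<notin> K \<Longrightarrow> \<phi> x = 0"
    by (rule test_functions_support[OF \<phi>]) (rule that)
  obtain L where L: "compact L" "L \<subseteq> \<Omega>" "\<And>x. x \<notin> L \<Longrightarrow> ?\<psi> x = 0"
    by (rule test_functions_support[OF \<psi>]) (rule that)
  have "bounded (?\<psi> ` L)"
    by (intro compact_imp_bounded compact_continuous_image L
        continuous_on_subset[OF test_functions_continuous[OF \<psi>]]) auto
  then obtain M where M: "0 < M" "\<And>x. x \<in> L \<Longrightarrow> \<bar>?\<psi> x\<bar> \<le> M"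
    by (auto simp: bounded_pos)
  have M': "\<bar>?\<psi> x\<bar> \<le> M" for x using M L(3)[of x] by (cases "x \<in> L") auto
  obtain R where R: "\<And>x. x \<in> K \<Longrightarrow> norm x \<le> R"
    using compact_imp_bounded[OF K(1)] by (auto simp: bounded_iff)
  have d: "((\<lambda>t. \<phi> (t *\<^sub>R ?e + x)) has_real_derivative ?\<psi> (t *\<^sub>R ?e + x)) (at t)" for t x
    by (rule pderiv_at_has_real_derivative[OF test_functions_differentiable[OF \<phi>]])
  have lim: "(\<lambda>n. s n x) \<longlonglongrightarrow> ?\<psi> x" for x
  proof -
    have "((\<lambda>t. (\<phi> (t *\<^sub>R ?e + x) - \<phi> x) / t) \<longlongrightarrow> ?\<psi> x) (at 0)"
      using d[of x 0] by (simp add: DERIV_def)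
    moreover have "filterlim h (at 0) sequentially"
      unfolding filterlim_at using h LIMSEQ_inverse_real_of_nat
      by (auto simp: h_def[abs_def] simp del: of_nat_Suc)
    ultimately show ?thesis unfolding s_def by (rule filterlim_compose)
  qed
  \<comment> \<open>Domination by one integrable function: the mean value theorem gives the bound
    \<open>M\<close>, and shifts of length at most 1 keep the quotient zero outside the ball of
    radius \<open>R + 1\<close>.\<close>
  have bound: "\<bar>s n x\<bar> \<le> M * indicator (cball 0 (R + 1)) x" for n x
  proof (cases "x \<in> cball 0 (R + 1)")
    case True
    obtain z where "\<phi> (h n *\<^sub>R ?e + x) - \<phi> (0 *\<^sub>R ?e + x) = (h n - 0) * ?\<psi> (z *\<^sub>R ?e + x)"
      using MVT2[OF h(1)[of n], of "\<lambda>t. \<phi> (t *\<^sub>R ?e + x)", OF d] by blast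
    then have "s n x = ?\<psi> (z *\<^sub>R ?e + x)" using h(1)[of n] by (simp add: s_def)
    then show ?thesis using True M' by simp
  next
    case False
    then have n: "R + 1 < norm x" by simp
    have "norm x \<le> norm (h n *\<^sub>R ?e + x) + norm (h n *\<^sub>R ?e)"
      using norm_triangle_ineq4[of "h n *\<^sub>R ?e + x" "h n *\<^sub>R ?e"] by simp
    also have "norm (h n *\<^sub>R ?e) \<le> 1" using h[of n] by (simp add: norm_axis_1)
    finally have "R < norm (h n *\<^sub>R ?e + x)" using n by linarith
    then have "\<phi> (h n *\<^sub>R ?e + x) = 0" "\<phi> x = 0" using K(3) R n by (force+)
    then show ?thesis using False by (simp add: s_def)
  qed
  have [measurable]: "\<phi> \<in> borel_measurable borel" "?\<psi> \<in> borel_measurable borel"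
    by (rule test_functions_borel[OF \<phi>] test_functions_borel[OF \<psi>])+
  have "(\<lambda>n. \<integral>x. s n x \<partial>lborel) \<longlonglongrightarrow> (\<integral>x. ?\<psi> x \<partial>lborel)"
  proof (rule integral_dominated_convergence[where w = "\<lambda>x. M * indicator (cball 0 (R + 1)) x"])
    show "integrable lborel (\<lambda>x :: real ^ 'd. M * indicator (cball 0 (R + 1)) x)"
      using emeasure_bounded_finite[OF bounded_cball, of "0 :: real ^ 'd" "R + 1"]
      by (intro integrable_mult_right integrable_real_indicator) auto
    show "s n \<in> borel_measurable lborel" for n unfolding s_def by measurable
  qed (use lim bound in auto)
  moreover have "(\<integral>x. s n x \<partial>lborel) = 0" for n
  proof -
    have "(\<integral>x. s n x \<partial>lborel) = ((\<integral>x. \<phi> (h n *\<^sub>R ?e + x) \<partial>lborel) - (\<integral>x. \<phi> x \<partial>lborel)) / h n"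
      unfolding s_def using test_functions_integrable[OF \<phi>]
      by (subst integral_divide_zero, subst Bochner_Integration.integral_diff)
        (auto intro: integrable_lborel_translation)
    then show ?thesis by (simp add: integral_lborel_translation)
  qed
  ultimately show ?thesis by (simp add: LIMSEQ_const_iff)
qed

text \<open>Square integrable functions are integrable on boxes, which have finite measure, by |t|
  <= 1 + t^2.\<close>

lemma integrable_indicator_box_times:
  fixes u :: "real ^ 'd \<Rightarrow> real"
  assumes [measurable]: "u \<in> borel_measurable borel" and sq: "integrable lborel (\<lambda>x. (u x)\<^sup>2)"
  shows "integrable lborel (\<lambda>x. indicator (box a b) x * u x)"
proof (rule Bochner_Integration.integrable_bound)
  show "integrable lborel (\<lambda>x. indicator (box a b) x + (u x)\<^sup>2)"
    using sq emeasure_bounded_finite[OF bounded_box, of a b]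
    by (intro Bochner_Integration.integrable_add integrable_real_indicator) auto
  have "\<bar>t\<bar> \<le> 1 + t\<^sup>2" for t :: real
    using abs_square_le_1[of t] self_le_power[of "\<bar>t\<bar>" 2] by (cases "\<bar>t\<bar> \<le> 1") (auto simp: add_increasing2)
  then show "AE x in lborel. norm (indicator (box a b) x * u x) \<le> norm (indicator (box a b) x + (u x)\<^sup>2)"
    by (intro AE_I2) (simp add: indicator_def)
qed measurable

text \<open>Testing with \<open>box_bump a b n\<close> and letting \<open>n\<close> tend to infinity
  replaces the bump by the indicator; the integrand on the limit box dominates.\<close>

lemma integral_box_eq_0:
  fixes u :: "real ^ 'd \<Rightarrow> real"
  assumes u[measurable]: "u \<in> borel_measurable borel" and sq: "integrable lborel (\<lambda>x. (u x)\<^sup>2)"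
    and 0: "\<And>\<phi>. \<phi> \<in> test_functions \<Omega> \<Longrightarrow> (\<integral>x. u x * \<phi> x \<partial>lborel) = 0"
    and sub: "cbox a b \<subseteq> \<Omega>"
  shows "(\<integral>x. indicator (box a b) x * u x \<partial>lborel) = 0"
proof -
  have "(\<lambda>n. \<integral>x. u x * box_bump a b n x \<partial>lborel) \<longlonglongrightarrow> (\<integral>x. indicator (box a b) x * u x \<partial>lborel)"
  proof (rule integral_dominated_convergence[where w = "\<lambda>x. \<bar>indicator (box a b) x * u x\<bar>"])
    show "integrable lborel (\<lambda>x. \<bar>indicator (box a b) x * u x\<bar>)"
      using integrable_indicator_box_times[OF u sq] by (rule integrable_abs)
    show "(\<lambda>x. u x * box_bump a b n x) \<in> borel_measurable lborel" for n
      using test_functions_borel[OF box_bump_test_function[OF sub, of n]] by simp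
    show "AE x in lborel. (\<lambda>n. u x * box_bump a b n x) \<longlonglongrightarrow> indicator (box a b) x * u x"
      by (intro AE_I2) (subst mult.commute, intro tendsto_mult tendsto_const box_bump_tendsto)
    have "\<bar>u x * box_bump a b n x\<bar> \<le> \<bar>indicator (box a b) x * u x\<bar>" for n x
      using box_bump_bounds[of a b n x] box_bump_outside[of x a b n]
      by (cases "x \<in> box a b") (auto simp: abs_mult mult_left_le)
    then show "AE x in lborel. norm (u x * box_bump a b n x) \<le> \<bar>indicator (box a b) x * u x\<bar>" for n
      by simp
  qed measurable
  then show ?thesis using 0[OF box_bump_test_function[OF sub]] by (simp add: LIMSEQ_const_iff)
qed

text \<open>Open boxes form an intersection-stable generator of the Borel sets, so the integral
  vanishes over every Borel set. The total integral handles complements.\<close>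

lemma AE_eq_0_if_box_integrals_eq_0:
  fixes v :: "real ^ 'd \<Rightarrow> real"
  assumes v: "integrable lborel v"
    and box: "\<And>c d. (\<integral>x. indicator (box c d) x * v x \<partial>lborel) = 0"
    and UNIV: "(\<integral>x. v x \<partial>lborel) = 0"
  shows "AE x in lborel. v x = 0"
proof (rule sigma_finite_measure.density_zero[OF lborel.sigma_finite_measure_axioms v])
  have [measurable]: "v \<in> borel_measurable borel" using v by auto
  let ?E = "range (\<lambda>(a, b). box a b :: (real ^ 'd) set)"
  fix A :: "(real ^ 'd) set" assume "A \<in> sets lborel"
  then have A: "A \<in> sigma_sets UNIV ?E" by (simp add: borel_eq_box)
  have E: "sigma_sets UNIV ?E = sets borel" by (simp add: borel_eq_box)
  have int: "set_integrable lborel B v" if "B \<in> sets borel" for B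
    using integrable_mult_indicator[of B lborel v] that v by (simp add: set_integrable_def)
  have "Int_stable ?E" by (auto simp: Int_stable_def box_Int_box)
  moreover have "?E \<subseteq> Pow UNIV" by simp
  ultimately show "set_lebesgue_integral lborel A v = 0"
    using A
  proof (induction rule: sigma_sets_induct_disjoint)
    case (basic B)
    then show ?case using box by (auto simp: set_lebesgue_integral_def)
  next
    case (compl B)
    then have B[measurable]: "B \<in> sets borel" using E by simp
    have "set_lebesgue_integral lborel (UNIV - B) v = (\<integral>x. v x - indicator B x *\<^sub>R v x \<partial>lborel)"
      unfolding set_lebesgue_integral_def
      by (intro Bochner_Integration.integral_cong) (auto simp: indicator_def)
    also have "\<dots> = (\<integral>x. v x \<partial>lborel) - set_lebesgue_integral lborel B v"
      unfolding set_lebesgue_integral_def using v int[OF B]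
      by (intro Bochner_Integration.integral_diff) (auto simp: set_integrable_def)
    finally show ?case using compl UNIV by simp
  next
    case (union B)
    then have B: "B i \<in> sets borel" for i using E by auto
    have "set_lebesgue_integral lborel (\<Union>i. B i) v = suminf (\<lambda>i. set_lebesgue_integral lborel (B i) v)"
      using union(1) B by (intro lebesgue_integral_countable_add int)
        (auto simp: disjoint_family_on_def)
    then show ?case using union by simp
  qed (auto simp: set_lebesgue_integral_def)
qed

text \<open>Keeps the closed hull of an intersection inside \<open>cbox a b\<close>, hence inside
  the domain, even when \<open>box c d\<close> sticks out of it.\<close>

lemma cbox_Int_box_subset:
  fixes a b c d :: "real ^ 'd"
  obtains p q where "box a b \<inter> box c d = box p q" "cbox p q \<subseteq> cbox a b"
proof
  let ?p = "(\<chi> i. max (a $ i) (c $ i)) :: real ^ 'd" and ?q = "(\<chi> i. min (b $ i) (d $ i)) :: real ^ 'd"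
  show "box a b \<inter> box c d = box ?p ?q" by (auto simp: mem_box_cart)
  show "cbox ?p ?q \<subseteq> cbox a b" by (auto simp: mem_box_cart)
qed

text \<open>An open set is a countable union of closed boxes, so it suffices to treat one of them.
  There \<open>u\<close> cut off to the open box has zero integral over all boxes.\<close>

lemma fundamental_lemma_calculus_of_variations:
  fixes u :: "real ^ 'd \<Rightarrow> real"
  assumes "open \<Omega>" and u[measurable]: "u \<in> borel_measurable borel"
    and sq: "integrable lborel (\<lambda>x. (u x)\<^sup>2)"
    and 0: "\<And>\<phi>. \<phi> \<in> test_functions \<Omega> \<Longrightarrow> (\<integral>x. u x * \<phi> x \<partial>lborel) = 0"
  shows "AE x in lborel. x \<in> \<Omega> \<longrightarrow> u x = 0"
proof -
  obtain \<D> where \<D>: "countable \<D>" "\<D> \<subseteq> Pow \<Omega>" "\<And>X. X \<in> \<D> \<Longrightarrow> \<exists>a b. X = cbox a b" "\<Union>\<D> = \<Omega>"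
    by (rule open_countable_Union_open_cbox[OF assms(1)]) (rule that)
  have "AE x in lborel. x \<in> X \<longrightarrow> u x = 0" if X: "X \<in> \<D>" for X
  proof -
    obtain a b where ab: "X = cbox a b" using \<D>(3) X by blast
    have sub: "cbox a b \<subseteq> \<Omega>" using \<D>(2) X ab by blast
    let ?v = "\<lambda>x. indicator (box a b) x * u x"
    have "AE x in lborel. ?v x = 0"
    proof (rule AE_eq_0_if_box_integrals_eq_0)
      fix c d :: "real ^ 'd"
      obtain p q where pq: "box a b \<inter> box c d = box p q" "cbox p q \<subseteq> cbox a b"
        by (rule cbox_Int_box_subset) (rule that)
      have "indicator (box c d) x * ?v x = indicator (box p q) x * u x" for x
        unfolding pq(1)[symmetric] by (auto simp: indicator_def)
      then show "(\<integral>x. indicator (box c d) x * ?v x \<partial>lborel) = 0"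
        using integral_box_eq_0[OF u sq 0 order_trans[OF pq(2) sub]] by (simp only:)
    qed (use integrable_indicator_box_times[OF u sq] integral_box_eq_0[OF u sq 0 sub] in auto)
    \<comment> \<open>The cut-off only controls the open box; the faces are a null set.\<close>
    moreover have "AE x in lborel. x \<notin> cbox a b - box a b"
    proof -
      have "cbox a b - box a b \<in> null_sets lebesgue"
        using negligible_frontier_interval negligible_iff_null_sets by blast
      then show ?thesis by (intro AE_not_in) (simp add: null_sets_completion_iff)
    qed
    ultimately show ?thesis unfolding ab by eventually_elim (auto simp: indicator_def)
  qed
  then have "AE x in lborel. \<forall>X\<in>\<D>. x \<in> X \<longrightarrow> u x = 0"
    by (subst AE_ball_countable[OF \<D>(1)]) blast
  then show ?thesis using \<D>(4) by (auto elim: eventually_mono)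
qed

section \<open>Weak derivatives\<close>

lemma L2_of_add:
  "square_integrable f \<Longrightarrow> square_integrable g \<Longrightarrow> L2_of (\<lambda>x. f x + g x) = L2_of f + L2_of g"
  by transfer (auto simp: L2_rel_def square_integrable_add)

lemma L2_of_scale: "square_integrable f \<Longrightarrow> L2_of (\<lambda>x. c * f x) = c *\<^sub>R L2_of f"
  by transfer (auto simp: L2_rel_def square_integrable_scale)

lemma L2_of_zero: "L2_of (\<lambda>x. 0) = 0"
  by transfer (simp add: L2_rel_def)

lemma AE_rep_L2_of: "square_integrable f \<Longrightarrow> AE x in lebesgue. rep_L2 (L2_of f) x = f x"
  using L2_of_eq_iff[OF square_integrable_rep_L2] by (metis L2_of_rep_L2)

text \<open>Lets the vanishing condition be tested on any representative instead of the chosen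
  \<open>rep_L2\<close>.\<close>

lemma L2_of_in_L2_on_iff:
  "square_integrable f \<Longrightarrow> L2_of f \<in> L2_on \<Omega> \<longleftrightarrow> (AE x in lebesgue. x \<notin> \<Omega> \<longrightarrow> f x = 0)"
  unfolding L2_on_def mem_Collect_eq
  by (rule eventually_subst, drule AE_rep_L2_of, erule eventually_mono) simp

lemma subspace_L2_on: "subspace (L2_on \<Omega>)"
proof -
  have 0: "(0 :: 'a L2) \<in> L2_on \<Omega>" using L2_of_in_L2_on_iff[of "\<lambda>x. 0" \<Omega>] by (simp add: L2_of_zero)
  have add: "f + g \<in> L2_on \<Omega>" if "f \<in> L2_on \<Omega>" "g \<in> L2_on \<Omega>" for f g :: "'a L2"
  proof -
    have "AE x in lebesgue. x \<notin> \<Omega> \<longrightarrow> rep_L2 f x + rep_L2 g x = 0"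
      using that unfolding L2_on_def mem_Collect_eq by eventually_elim auto
    then have "L2_of (\<lambda>x. rep_L2 f x + rep_L2 g x) \<in> L2_on \<Omega>"
      by (simp add: L2_of_in_L2_on_iff square_integrable_add square_integrable_rep_L2)
    then show ?thesis by (simp add: L2_of_add square_integrable_rep_L2 L2_of_rep_L2)
  qed
  have scale: "r *\<^sub>R f \<in> L2_on \<Omega>" if "f \<in> L2_on \<Omega>" for f :: "'a L2" and r
  proof -
    have "AE x in lebesgue. x \<notin> \<Omega> \<longrightarrow> r * rep_L2 f x = 0"
      using that unfolding L2_on_def mem_Collect_eq by eventually_elim auto
    then have "L2_of (\<lambda>x. r * rep_L2 f x) \<in> L2_on \<Omega>"
      by (simp add: L2_of_in_L2_on_iff square_integrable_scale square_integrable_rep_L2)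
    then show ?thesis by (simp add: L2_of_scale square_integrable_rep_L2 L2_of_rep_L2)
  qed
  show ?thesis by (rule subspaceI) (use 0 add scale in auto)
qed

lemma subspace_L2_vec: "subspace (L2_vec \<Omega>)"
  by (rule subspaceI)
    (auto simp: L2_vec_def subspace_0[OF subspace_L2_on] subspace_add[OF subspace_L2_on]
      subspace_scale[OF subspace_L2_on])

text \<open>The fundamental lemma for classes: it gives vanishing on \<Omega>, and membership in
  \<open>L2_on \<Omega>\<close> gives vanishing elsewhere.\<close>

lemma L2_on_eq_0:
  fixes p :: "(real ^ 'd) L2"
  assumes "open \<Omega>" "p \<in> L2_on \<Omega>" and 0: "\<And>\<phi>. \<phi> \<in> test_functions \<Omega> \<Longrightarrow> inner p (L2_of \<phi>) = 0"
  shows "p = 0"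
proof -
  have sq: "square_integrable (rep_L2 p)" by (rule square_integrable_rep_L2)
  \<comment> \<open>The fundamental lemma is stated for Borel functions and \<open>lborel\<close>,
    so the Lebesgue measurable representative is exchanged for an almost everywhere equal Borel
    one.\<close>
  then obtain u where u[measurable]: "u \<in> borel_measurable borel" and ae: "AE x in lborel. rep_L2 p x = u x"
    using completion_ex_borel_measurable_real[of "rep_L2 p" lborel] by (auto simp: square_integrable_def)
  have ae': "AE x in lebesgue. rep_L2 p x = u x" using ae by (rule AE_completion)
  have ul: "f \<in> borel_measurable lebesgue" if "f \<in> borel_measurable borel" for f :: "real ^ 'd \<Rightarrow> real"
    using that by (intro measurable_completion) simp
  have rl: "rep_L2 p \<in> borel_measurable lebesgue" using sq by (simp add: square_integrable_def)
  have "integrable lebesgue (\<lambda>x. (u x)\<^sup>2)"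
    using sq ae' rl ul[OF u] unfolding square_integrable_def
    by (subst integrable_cong_AE[of _ _ "\<lambda>x. (rep_L2 p x)\<^sup>2"]) (auto elim: eventually_mono)
  then have "integrable lborel (\<lambda>x. (u x)\<^sup>2)"
    by (subst (asm) integrable_completion) auto
  moreover have "(\<integral>x. u x * \<phi> x \<partial>lborel) = 0" if \<phi>: "\<phi> \<in> test_functions \<Omega>" for \<phi>
  proof -
    have [measurable]: "\<phi> \<in> borel_measurable borel" by (rule test_functions_borel[OF \<phi>])
    have "(\<integral>x. u x * \<phi> x \<partial>lborel) = (\<integral>x. u x * \<phi> x \<partial>lebesgue)"
      by (rule integral_completion[symmetric]) measurable
    also have "\<dots> = (\<integral>x. rep_L2 p x * \<phi> x \<partial>lebesgue)"
      using ae' rl ul[OF u] ul[OF test_functions_borel[OF \<phi>]]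
      by (intro integral_cong_AE) (auto elim: eventually_mono)
    also have "\<dots> = inner p (L2_of \<phi>)"
      using inner_L2_of[OF sq test_functions_square_integrable[OF \<phi>]] by (simp add: L2_of_rep_L2)
    finally show ?thesis using 0[OF \<phi>] by simp
  qed
  ultimately have "AE x in lborel. x \<in> \<Omega> \<longrightarrow> u x = 0"
    by (rule fundamental_lemma_calculus_of_variations[OF assms(1) u])
  then have "AE x in lebesgue. x \<in> \<Omega> \<longrightarrow> u x = 0" by (rule AE_completion)
  then have "AE x in lebesgue. rep_L2 p x = 0"
    using ae' assms(2) unfolding L2_on_def mem_Collect_eq by eventually_elim auto
  then have "L2_of (rep_L2 p) = L2_of (\<lambda>x. 0)" by (simp add: L2_of_eq_iff sq)
  then show ?thesis by (simp add: L2_of_rep_L2 L2_of_zero)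
qed

lemma is_weak_grad_add:
  "is_weak_grad \<Omega> u g \<Longrightarrow> is_weak_grad \<Omega> v h \<Longrightarrow> is_weak_grad \<Omega> (u + v) (g + h)"
  by (simp add: is_weak_grad_def subspace_add[OF subspace_L2_vec] inner_add_left)

lemma is_weak_grad_scale: "is_weak_grad \<Omega> u g \<Longrightarrow> is_weak_grad \<Omega> (r *\<^sub>R u) (r *\<^sub>R g)"
  by (simp add: is_weak_grad_def subspace_scale[OF subspace_L2_vec])

lemma is_weak_div_add:
  "is_weak_div \<Omega> u g \<Longrightarrow> is_weak_div \<Omega> v h \<Longrightarrow> is_weak_div \<Omega> (u + v) (g + h)"
  by (simp add: is_weak_div_def subspace_add[OF subspace_L2_on] inner_add_left)

lemma is_weak_div_scale: "is_weak_div \<Omega> u g \<Longrightarrow> is_weak_div \<Omega> (r *\<^sub>R u) (r *\<^sub>R g)"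
  by (simp add: is_weak_div_def subspace_scale[OF subspace_L2_on])

text \<open>Each component of the difference lies in \<open>L2_on \<Omega>\<close> and is orthogonal
  to all test functions.\<close>

lemma is_weak_grad_unique:
  assumes "open \<Omega>" "is_weak_grad \<Omega> u g" "is_weak_grad \<Omega> u h"
  shows "g = h"
proof -
  have "g $ i - h $ i = 0" for i
    by (rule L2_on_eq_0[OF assms(1)])
      (use assms(2,3) in \<open>auto simp: is_weak_grad_def L2_vec_def subspace_diff[OF subspace_L2_on] inner_diff_left\<close>)
  then show ?thesis by (simp add: vec_eq_iff)
qed

lemma weak_grad_eq: "open \<Omega> \<Longrightarrow> is_weak_grad \<Omega> u g \<Longrightarrow> weak_grad \<Omega> u = g"
  unfolding weak_grad_def by (rule the_equality) (auto intro: is_weak_grad_unique)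

lemma is_weak_grad_weak_grad: "open \<Omega> \<Longrightarrow> u \<in> H1 \<Omega> \<Longrightarrow> is_weak_grad \<Omega> u (weak_grad \<Omega> u)"
  unfolding H1_def using weak_grad_eq by fastforce

lemma subspace_H1: "subspace (H1 \<Omega>)"
proof (rule subspaceI)
  have "is_weak_grad \<Omega> 0 0" by (simp add: is_weak_grad_def subspace_0[OF subspace_L2_vec])
  then show "0 \<in> H1 \<Omega>" by (auto simp: H1_def subspace_0[OF subspace_L2_on])
qed (auto simp: H1_def subspace_add[OF subspace_L2_on] subspace_scale[OF subspace_L2_on]
    intro: is_weak_grad_add is_weak_grad_scale)

lemma subspace_Hdiv: "subspace (Hdiv \<Omega>)"
proof (rule subspaceI)
  have "is_weak_div \<Omega> 0 0" by (simp add: is_weak_div_def subspace_0[OF subspace_L2_on])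
  then show "0 \<in> Hdiv \<Omega>" by (auto simp: Hdiv_def subspace_0[OF subspace_L2_vec])
qed (auto simp: Hdiv_def subspace_add[OF subspace_L2_vec] subspace_scale[OF subspace_L2_vec]
    intro: is_weak_div_add is_weak_div_scale)

text \<open>Uniqueness transfers additivity from the relation \<open>is_weak_grad\<close> to its
  description by \<open>THE\<close>.\<close>

lemma weak_grad_add:
  assumes "open \<Omega>" "u \<in> H1 \<Omega>" "v \<in> H1 \<Omega>"
  shows "weak_grad \<Omega> (u + v) = weak_grad \<Omega> u + weak_grad \<Omega> v"
  by (intro weak_grad_eq is_weak_grad_add is_weak_grad_weak_grad assms)

lemma weak_grad_scale:
  assumes "open \<Omega>" "u \<in> H1 \<Omega>"
  shows "weak_grad \<Omega> (r *\<^sub>R u) = r *\<^sub>R weak_grad \<Omega> u"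
  by (intro weak_grad_eq is_weak_grad_scale is_weak_grad_weak_grad assms)

text \<open>The product of the two functions is again a test function, so its partial derivative
  integrates to zero; the Leibniz rule splits that integral.\<close>

lemma integral_pderiv_mult:
  assumes \<phi>: "\<phi> \<in> test_functions \<Omega>" and \<psi>: "\<psi> \<in> test_functions \<Omega>"
  shows "(\<integral>x. \<phi> x * pderiv_at i \<psi> x \<partial>lebesgue) = - (\<integral>x. pderiv_at i \<phi> x * \<psi> x \<partial>lebesgue)"
proof -
  have sq: "square_integrable \<phi>" "square_integrable \<psi>"
    "square_integrable (pderiv_at i \<phi>)" "square_integrable (pderiv_at i \<psi>)"
    using \<phi> \<psi> by (auto intro: test_functions_square_integrable pderiv_test_function)
  have d: "\<phi> differentiable (at x)" "\<psi> differentiable (at x)" for x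
    using \<phi> \<psi> test_functions_differentiable by auto
  have p: "pderiv_at i (\<lambda>x. \<phi> x * \<psi> x) = (\<lambda>x. \<phi> x * pderiv_at i \<psi> x + pderiv_at i \<phi> x * \<psi> x)"
    using pderiv_at_eq[OF has_derivative_mult[OF d[unfolded frechet_derivative_works]]]
    by (auto simp: pderiv_at_def)
  have t: "(\<lambda>x. \<phi> x * \<psi> x) \<in> test_functions \<Omega>"
    using \<phi> by (intro test_functions_mult[OF \<psi>]) (auto simp: test_functions_def)
  have "0 = (\<integral>x. pderiv_at i (\<lambda>x. \<phi> x * \<psi> x) x \<partial>lborel)"
    using integral_pderiv_test_function[OF t] by simp
  also have "\<dots> = (\<integral>x. pderiv_at i (\<lambda>x. \<phi> x * \<psi> x) x \<partial>lebesgue)"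
    using test_functions_borel[OF pderiv_test_function[OF t]] by (subst integral_completion) auto
  also have "\<dots> = (\<integral>x. \<phi> x * pderiv_at i \<psi> x \<partial>lebesgue) + (\<integral>x. pderiv_at i \<phi> x * \<psi> x \<partial>lebesgue)"
    unfolding p using sq by (intro Bochner_Integration.integral_add square_integrable_mult)
  finally show ?thesis by simp
qed

lemma L2_of_test_function_in_L2_on:
  assumes "\<phi> \<in> test_functions \<Omega>" shows "L2_of \<phi> \<in> L2_on \<Omega>"
proof -
  obtain K where K: "K \<subseteq> \<Omega>" "\<And>x. x \<notin> K \<Longrightarrow> \<phi> x = 0"
    by (rule test_functions_support[OF assms]) (rule that)
  then have "\<phi> x = 0" if "x \<notin> \<Omega>" for x using that by blast
  then show ?thesis by (subst L2_of_in_L2_on_iff[OF test_functions_square_integrable[OF assms]]) simp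
qed

lemma is_weak_grad_L2_of:
  assumes "\<phi> \<in> test_functions \<Omega>"
  shows "is_weak_grad \<Omega> (L2_of \<phi>) (\<chi> i. L2_of (pderiv_at i \<phi>))"
  unfolding is_weak_grad_def
proof (intro conjI ballI allI)
  show "(\<chi> i. L2_of (pderiv_at i \<phi>)) \<in> L2_vec \<Omega>"
    by (simp add: L2_vec_def L2_of_test_function_in_L2_on pderiv_test_function[OF assms])
  note sq = test_functions_square_integrable[OF assms]
    test_functions_square_integrable[OF pderiv_test_function[OF assms]]
  fix \<psi> i assume \<psi>: "\<psi> \<in> test_functions \<Omega>"
  note sq' = test_functions_square_integrable[OF \<psi>]
    test_functions_square_integrable[OF pderiv_test_function[OF \<psi>]]
  show "inner (L2_of \<phi>) (L2_of (pderiv_at i \<psi>)) =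
      - inner ((\<chi> i. L2_of (pderiv_at i \<phi>)) $ i) (L2_of \<psi>)"
    by (simp add: inner_L2_of sq sq' integral_pderiv_mult[OF assms \<psi>])
qed

section \<open>The norm of H^1 and the subspace H^1_0\<close>

lemma L2_of_test_function_in_H1: "\<phi> \<in> test_functions \<Omega> \<Longrightarrow> L2_of \<phi> \<in> H1 \<Omega>"
  unfolding H1_def using is_weak_grad_L2_of L2_of_test_function_in_L2_on by blast

text \<open>The graph norm in a product of L_2 spaces. Triangle inequality and homogeneity are
  thereby inherited from the norm of the product type.\<close>

lemma H1_norm_eq: "ip_norm (H1_inner \<Omega>) u = norm (u, weak_grad \<Omega> u)"
  by (simp add: ip_norm_def H1_inner_def norm_Pair power2_norm_eq_inner)

lemma H1_norm_triangle:
  assumes "open \<Omega>" "u \<in> H1 \<Omega>" "v \<in> H1 \<Omega>"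
  shows "ip_norm (H1_inner \<Omega>) (u + v) \<le> ip_norm (H1_inner \<Omega>) u + ip_norm (H1_inner \<Omega>) v"
  using norm_triangle_ineq[of "(u, weak_grad \<Omega> u)" "(v, weak_grad \<Omega> v)"]
  by (simp add: H1_norm_eq weak_grad_add[OF assms])

lemma H1_norm_scale:
  assumes "open \<Omega>" "u \<in> H1 \<Omega>"
  shows "ip_norm (H1_inner \<Omega>) (r *\<^sub>R u) = \<bar>r\<bar> * ip_norm (H1_inner \<Omega>) u"
  using norm_scaleR[of r "(u, weak_grad \<Omega> u)"]
  by (simp add: H1_norm_eq weak_grad_scale[OF assms])

text \<open>Approximating test functions are added and scaled along with their limits. Their
  membership in H^1 keeps all differences where the norm laws hold.\<close>

lemma subspace_H10:
  assumes "open \<Omega>" shows "subspace (H10 \<Omega>)"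
proof (rule subspaceI)
  let ?N = "ip_norm (H1_inner \<Omega>)"
  have diff: "u - L2_of \<phi> \<in> H1 \<Omega>" if "u \<in> H1 \<Omega>" "\<phi> \<in> test_functions \<Omega>" for u \<phi>
    using that by (intro subspace_diff[OF subspace_H1] L2_of_test_function_in_H1)
  have "?N (0 - L2_of (\<lambda>x. 0)) = 0"
    using H1_norm_scale[OF assms subspace_0[OF subspace_H1], of 0] by (simp add: L2_of_zero)
  then show "0 \<in> H10 \<Omega>"
    unfolding H10_def using subspace_0[OF subspace_H1]
    by (auto intro!: bexI[OF _ zero_test_function])
  fix u assume u: "u \<in> H10 \<Omega>"
  then have u1: "u \<in> H1 \<Omega>" by (simp add: H10_def)
  show "u + v \<in> H10 \<Omega>" if v: "v \<in> H10 \<Omega>" for v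
    unfolding H10_def mem_Collect_eq
  proof (intro conjI allI impI)
    have v1: "v \<in> H1 \<Omega>" using v by (simp add: H10_def)
    show "u + v \<in> H1 \<Omega>" using u1 v1 by (rule subspace_add[OF subspace_H1])
    fix \<epsilon> :: real assume "0 < \<epsilon>"
    then have e: "0 < \<epsilon> / 2" by simp
    obtain \<phi> where \<phi>: "\<phi> \<in> test_functions \<Omega>" "?N (u - L2_of \<phi>) < \<epsilon> / 2"
      using u e unfolding H10_def by blast
    obtain \<psi> where \<psi>: "\<psi> \<in> test_functions \<Omega>" "?N (v - L2_of \<psi>) < \<epsilon> / 2"
      using v e unfolding H10_def by blast
    have eq: "u + v - L2_of (\<lambda>x. \<phi> x + \<psi> x) = (u - L2_of \<phi>) + (v - L2_of \<psi>)"
      using \<phi> \<psi> by (simp add: L2_of_add test_functions_square_integrable)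
    have "?N (u + v - L2_of (\<lambda>x. \<phi> x + \<psi> x)) < \<epsilon>"
      unfolding eq
      using H1_norm_triangle[OF assms diff[OF u1 \<phi>(1)] diff[OF v1 \<psi>(1)]] \<phi>(2) \<psi>(2) by linarith
    then show "\<exists>\<phi>\<in>test_functions \<Omega>. ?N (u + v - L2_of \<phi>) < \<epsilon>"
      using test_functions_add[OF \<phi>(1) \<psi>(1)] by blast
  qed
  show "r *\<^sub>R u \<in> H10 \<Omega>" for r
    unfolding H10_def mem_Collect_eq
  proof (intro conjI allI impI)
    show "r *\<^sub>R u \<in> H1 \<Omega>" using u1 by (rule subspace_scale[OF subspace_H1])
    fix \<epsilon> :: real assume "0 < \<epsilon>"
    \<comment> \<open>Adding 1 to \<open>\<bar>r\<bar>\<close> covers \<open>r = 0\<close>.\<close>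
    then have "0 < \<epsilon> / (\<bar>r\<bar> + 1)" by simp
    then obtain \<phi> where \<phi>: "\<phi> \<in> test_functions \<Omega>" "?N (u - L2_of \<phi>) < \<epsilon> / (\<bar>r\<bar> + 1)"
      using u unfolding H10_def by blast
    have "r *\<^sub>R u - L2_of (\<lambda>x. r * \<phi> x) = r *\<^sub>R (u - L2_of \<phi>)"
      using \<phi> by (simp add: L2_of_scale test_functions_square_integrable scaleR_diff_right)
    then have "?N (r *\<^sub>R u - L2_of (\<lambda>x. r * \<phi> x)) = \<bar>r\<bar> * ?N (u - L2_of \<phi>)"
      by (simp add: H1_norm_scale[OF assms diff[OF u1 \<phi>(1)]])
    also have "\<dots> \<le> (\<bar>r\<bar> + 1) * ?N (u - L2_of \<phi>)"
      by (intro mult_right_mono) (auto simp: H1_norm_eq)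
    also have "\<dots> < \<epsilon>" using \<phi>(2) by (simp add: field_simps)
    finally show "\<exists>\<phi>\<in>test_functions \<Omega>. ?N (r *\<^sub>R u - L2_of \<phi>) < \<epsilon>"
      using test_functions_scale[OF \<phi>(1)] by blast
  qed
qed

section \<open>The parametric forms\<close>

text \<open>Every element of the frame space is \<open>D u\<close> with \<open>u\<close> in the span
  of the frame, hence in \<open>U\<close>. Coercivity bounds the form below by the norm of
  \<open>u\<close>, and boundedness of \<open>D\<close> passes to the norm of
  \<open>D u\<close>.\<close>

lemma elliptic_on_H_frame:
  fixes B :: "'y \<Rightarrow> (real ^ 'd) L2 ^ 'm \<Rightarrow> (real ^ 'd) L2 ^ 'm \<Rightarrow> real"
  assumes par: "parametric_setting \<Omega> U nU D Y B cU CU" and U: "subspace U"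
    and fr: "uniform_frame_family U nU I \<Phi> c\<Phi> C\<Phi>"
  obtains c where "0 < c"
    "\<And>J y h. y \<in> Y \<Longrightarrow> h \<in> H_frame D (I J) (\<Phi> J) \<Longrightarrow> c * (norm h)\<^sup>2 \<le> B y h h"
proof -
  have cU: "0 < cU" and coer: "\<And>u y. u \<in> U \<Longrightarrow> y \<in> Y \<Longrightarrow> cU * (nU u)\<^sup>2 \<le> B y (D u) (D u)"
    using par by (auto simp: parametric_setting_def)
  have "bounded_linear_map_on U nU norm D"
    using par by (simp add: parametric_setting_def isomorphism_on_def)
  then obtain K where K: "\<And>u. u \<in> U \<Longrightarrow> norm (D u) \<le> K * nU u"
    unfolding bounded_linear_map_on_def by blast
  \<comment> \<open>The summand 1 keeps the denominator positive even for \<open>K = 0\<close>; the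
    constant depends on neither \<open>J\<close> nor \<open>y\<close>.\<close>
  have "cU / (K\<^sup>2 + 1) * (norm h)\<^sup>2 \<le> B y h h" if y: "y \<in> Y" and h: "h \<in> H_frame D (I J) (\<Phi> J)" for J y h
  proof -
    have "\<Phi> J ` I J \<subseteq> U" using fr by (simp add: uniform_frame_family_def)
    then have "span (\<Phi> J ` I J) \<subseteq> U" using U by (rule span_minimal)
    moreover obtain v where v: "h = D (synthesis (I J) (\<Phi> J) v)"
      using h unfolding H_frame_def by auto
    ultimately obtain u where u: "u \<in> U" "h = D u"
      using subsetD[OF _ synthesis_in_span] by blast
    have "(norm h)\<^sup>2 \<le> K\<^sup>2 * (nU u)\<^sup>2"
      using power_mono[OF K[OF u(1)] norm_ge_zero, of 2] u(2) by (simp add: power_mult_distrib)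
    also have "\<dots> \<le> (K\<^sup>2 + 1) * (nU u)\<^sup>2" by (simp add: mult_right_mono)
    finally have "cU * (norm h)\<^sup>2 \<le> cU * ((K\<^sup>2 + 1) * (nU u)\<^sup>2)" using cU by simp
    then have "cU / (K\<^sup>2 + 1) * (norm h)\<^sup>2 \<le> cU * (nU u)\<^sup>2"
      by (simp add: field_simps add_pos_nonneg add_nonneg_pos)
    also have "\<dots> \<le> B y h h" using coer[OF u(1) y] u(2) by simp
    finally show ?thesis .
  qed
  moreover have "0 < cU / (K\<^sup>2 + 1)" using cU by (simp add: add_nonneg_pos)
  ultimately show thesis using that by blast
qed

lemma uniformly_bounded_ellipticI:
  fixes B :: "'y \<Rightarrow> 'h::real_normed_vector \<Rightarrow> 'h \<Rightarrow> real"
  assumes "0 < c" "\<And>J y h. y \<in> Y \<Longrightarrow> h \<in> V J \<Longrightarrow> c * (norm h)\<^sup>2 \<le> B y h h"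
    and "\<And>y h h'. y \<in> Y \<Longrightarrow> \<bar>B y h h'\<bar> \<le> C * norm h * norm h'"
  shows "uniformly_bounded_elliptic Y B V"
  unfolding uniformly_bounded_elliptic_def
\<comment> \<open>The maximum secures the required order of the two constants.\<close>
proof (rule exI[of _ c], rule exI[of _ "max c C"], intro conjI allI ballI)
  fix y and h h' :: 'h assume "y \<in> Y"
  have "C * (norm h * norm h') \<le> max c C * (norm h * norm h')" by (intro mult_right_mono) auto
  then show "\<bar>B y h h'\<bar> \<le> max c C * norm h * norm h'"
    using assms(3)[OF \<open>y \<in> Y\<close>, of h h'] by (simp add: mult.assoc)
qed (use assms in auto)

text \<open>The pointwise bound on the multiplier is squared and integrated in each component, then
  summed over components.\<close>

lemma norm_mult_on_le:
  fixes g :: "(real ^ 'd) L2 ^ 'm"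
  assumes \<Omega>: "\<Omega> \<in> sets lebesgue" and \<alpha>: "\<alpha> \<in> borel_measurable (lebesgue_on \<Omega>)"
    and A: "0 \<le> A" "\<And>x. x \<in> \<Omega> \<Longrightarrow> \<bar>\<alpha> x\<bar> \<le> A"
  shows "norm (mult_on \<Omega> \<alpha> g) \<le> A * norm g"
proof -
  have "norm (mult_on \<Omega> \<alpha> g $ i) \<le> A * norm (g $ i)" for i
  proof -
    let ?f = "rep_L2 (g $ i)" and ?F = "\<lambda>x. indicator \<Omega> x * \<alpha> x * rep_L2 (g $ i) x"
    have f: "square_integrable ?f" by (rule square_integrable_rep_L2)
    have "(\<lambda>x. indicator \<Omega> x * \<alpha> x) \<in> borel_measurable lebesgue"
      using \<alpha> \<Omega> by (subst (asm) borel_measurable_restrict_space_iff) auto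
    moreover have "?f \<in> borel_measurable lebesgue" using f by (simp add: square_integrable_def)
    ultimately have m: "?F \<in> borel_measurable lebesgue" by (rule borel_measurable_times)
    have le: "(?F x)\<^sup>2 \<le> A\<^sup>2 * (?f x)\<^sup>2" for x
    proof -
      have "\<bar>?F x\<bar> \<le> A * \<bar>?f x\<bar>"
        using A by (auto simp: indicator_def abs_mult intro: mult_right_mono)
      from power_mono[OF this abs_ge_zero, of 2] show ?thesis by (simp add: power_mult_distrib)
    qed
    have int: "integrable lebesgue (\<lambda>x. A\<^sup>2 * (?f x)\<^sup>2)"
      using f by (simp add: square_integrable_def)
    have F2: "integrable lebesgue (\<lambda>x. (?F x)\<^sup>2)"
      by (rule Bochner_Integration.integrable_bound[OF int]) (use m le in auto)
    \<comment> \<open>This must come first: \<open>L2_of\<close> returns 0 on functions that are not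
      square integrable.\<close>
    then have F: "square_integrable ?F" using m by (simp add: square_integrable_def)
    have "(norm (mult_on \<Omega> \<alpha> g $ i))\<^sup>2 = (\<integral>x. (?F x)\<^sup>2 \<partial>lebesgue)"
      unfolding power2_norm_eq_inner mult_on_def vec_lambda_beta
      by (simp only: inner_L2_of[OF F F] power2_eq_square)
    also have "\<dots> \<le> (\<integral>x. A\<^sup>2 * (?f x)\<^sup>2 \<partial>lebesgue)"
      by (rule integral_mono[OF F2 int le])
    also have "\<dots> = A\<^sup>2 * (norm (g $ i))\<^sup>2"
      unfolding power2_norm_eq_inner using inner_L2_of[OF f f]
      by (simp add: L2_of_rep_L2 power2_eq_square)
    finally have "(norm (mult_on \<Omega> \<alpha> g $ i))\<^sup>2 \<le> (A * norm (g $ i))\<^sup>2" by (simp add: power_mult_distrib)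
    then show ?thesis by (rule power2_le_imp_le) (simp add: A)
  qed
  then have "norm (mult_on \<Omega> \<alpha> g) \<le> L2_set (\<lambda>i. A * norm (g $ i)) UNIV"
    unfolding norm_vec_def by (intro L2_set_mono) auto
  also have "\<dots> = A * norm g" unfolding norm_vec_def using A by (simp add: L2_set_right_distrib)
  finally show ?thesis .
qed

lemma form_E_bounded:
  assumes "open \<Omega>" "admissible_coefficients \<Omega> Y a a1 ainf" "y \<in> Y"
  shows "\<bar>form_E \<Omega> a y g h\<bar> \<le> ainf * norm g * norm h"
proof -
  have "norm (mult_on \<Omega> (a y) g) \<le> ainf * norm g"
    using assms by (intro norm_mult_on_le) (force simp: admissible_coefficients_def)+
  then show ?thesis
    unfolding form_E_def
    using order_trans[OF Cauchy_Schwarz_ineq2 mult_right_mono[OF _ norm_ge_zero]] by blast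
qed

lemma norm_comp_le:
  fixes h :: "'a::real_normed_vector ^ ('d::finite + 'd + unit)"
  shows "norm (comp_g h) \<le> norm h" "norm (comp_\<tau> h) \<le> norm h" "norm (comp_p h) \<le> norm h"
proof -
  \<comment> \<open>Each vector block selects some of the 2d+1 components through an injective index
    map, so its sum of squares is a partial sum.\<close>
  have reindex: "norm (\<chi> i. h $ f i) \<le> norm h" if "inj f" for f :: "'d \<Rightarrow> 'd + 'd + unit"
  proof -
    have "(\<Sum>i\<in>UNIV. (norm (h $ f i))\<^sup>2) = (\<Sum>k\<in>range f. (norm (h $ k))\<^sup>2)"
      using that by (simp add: sum.reindex)
    also have "\<dots> \<le> (\<Sum>k\<in>UNIV. (norm (h $ k))\<^sup>2)" by (intro sum_mono2) auto
    finally show ?thesis by (simp add: norm_vec_def L2_set_def)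
  qed
  show "norm (comp_g h) \<le> norm h" unfolding comp_g_def by (rule reindex) (simp add: inj_def)
  show "norm (comp_\<tau> h) \<le> norm h" unfolding comp_\<tau>_def by (rule reindex) (simp add: inj_def)
  show "norm (comp_p h) \<le> norm h" unfolding comp_p_def by (rule Finite_Cartesian_Product.norm_nth_le)
qed

text \<open>The summand 1 comes from the divergence component. The map sending (g, tau, p) to
  a_y^(-1) tau - g has norm at most \<open>1 / a1 + 1\<close>, which enters once for each
  argument.\<close>

lemma form_LS_bounded:
  assumes "open \<Omega>" "admissible_coefficients \<Omega> Y a a1 ainf" "y \<in> Y"
  shows "\<bar>form_LS \<Omega> a y h k\<bar> \<le> (1 + (1 / a1 + 1)\<^sup>2) * norm h * norm k"
proof -
  let ?r = "\<lambda>h. mult_on \<Omega> (\<lambda>x. inverse (a y x)) (comp_\<tau> h) - comp_g h"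
  have a: "0 < a1" "a y \<in> borel_measurable (lebesgue_on \<Omega>)" "\<And>x. x \<in> \<Omega> \<Longrightarrow> a1 \<le> a y x"
    using assms by (auto simp: admissible_coefficients_def)
  have "\<bar>inverse (a y x)\<bar> \<le> 1 / a1" if "x \<in> \<Omega>" for x
    using a(1) a(3)[OF that] by (simp add: field_simps)
  then have r: "norm (?r h) \<le> (1 / a1 + 1) * norm h" for h
  proof -
    assume *: "\<And>x. x \<in> \<Omega> \<Longrightarrow> \<bar>inverse (a y x)\<bar> \<le> 1 / a1"
    have "norm (mult_on \<Omega> (\<lambda>x. inverse (a y x)) (comp_\<tau> h)) \<le> 1 / a1 * norm (comp_\<tau> h)"
      using assms(1) a * by (intro norm_mult_on_le) auto
    also have "\<dots> \<le> 1 / a1 * norm h" using a(1) norm_comp_le(2) by (intro mult_left_mono) auto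
    finally show ?thesis
      using norm_triangle_ineq4[of "mult_on \<Omega> (\<lambda>x. inverse (a y x)) (comp_\<tau> h)" "comp_g h"] norm_comp_le(1)[of h]
      by (simp add: distrib_right)
  qed
  have "\<bar>inner (?r h) (?r k)\<bar> \<le> norm (?r h) * norm (?r k)" by (rule Cauchy_Schwarz_ineq2)
  also have "\<dots> \<le> ((1 / a1 + 1) * norm h) * ((1 / a1 + 1) * norm k)"
    using a(1) by (intro mult_mono r) auto
  finally have 1: "\<bar>inner (?r h) (?r k)\<bar> \<le> (1 / a1 + 1)\<^sup>2 * norm h * norm k"
    by (simp add: power2_eq_square mult_ac)
  have "\<bar>inner (comp_p h) (comp_p k)\<bar> \<le> norm (comp_p h) * norm (comp_p k)" by (rule Cauchy_Schwarz_ineq2)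
  also have "\<dots> \<le> norm h * norm k" by (intro mult_mono norm_comp_le) auto
  finally have 2: "\<bar>inner (comp_p h) (comp_p k)\<bar> \<le> norm h * norm k" .
  show ?thesis unfolding form_LS_def using 1 2 by (simp add: distrib_right)
qed

theorem proposition4:
  fixes \<Omega> :: "(real ^ 'd) set" and Y :: "'y set"
    and I :: "nat \<Rightarrow> 'i set" and c\<Phi> C\<Phi> :: "nat \<Rightarrow> real" and cU CU :: real
    and U :: "'u::real_vector set" and ip :: "'u \<Rightarrow> 'u \<Rightarrow> real"
    and D :: "'u \<Rightarrow> (real ^ 'd) L2 ^ 'm"
    and B :: "'y \<Rightarrow> (real ^ 'd) L2 ^ 'm \<Rightarrow> (real ^ 'd) L2 ^ 'm \<Rightarrow> real"
    and \<Phi> :: "nat \<Rightarrow> 'i \<Rightarrow> 'u"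
    and a :: "'y \<Rightarrow> real ^ 'd \<Rightarrow> real" and a1 ainf :: real
    and \<Phi>E :: "nat \<Rightarrow> 'i \<Rightarrow> (real ^ 'd) L2"
    and \<Phi>LS :: "nat \<Rightarrow> 'i \<Rightarrow> (real ^ 'd) L2 \<times> ((real ^ 'd) L2 ^ 'd)"
  assumes "domain \<Omega>"
  shows
    "(hilbert_space_on U ip \<and>
      (\<forall>y\<in>Y. bilinear_form_on (L2_vec \<Omega>) (B y)) \<and>
      parametric_setting \<Omega> U (ip_norm ip) D Y B cU CU \<and>
      uniform_frame_family U (ip_norm ip) I \<Phi> c\<Phi> C\<Phi>
      \<longrightarrow> uniformly_well_conditioned D I \<Phi>)
     \<and>
     (admissible_coefficients \<Omega> Y a a1 ainf \<and>
      parametric_setting \<Omega> (H10 \<Omega>) (ip_norm (H1_inner \<Omega>)) (weak_grad \<Omega>) Y (form_E \<Omega> a) cU CU \<and>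
      uniform_frame_family (H10 \<Omega>) (ip_norm (H1_inner \<Omega>)) I \<Phi>E c\<Phi> C\<Phi>
      \<longrightarrow> uniformly_bounded_elliptic Y (form_E \<Omega> a)
            (\<lambda>J. H_frame (weak_grad \<Omega>) (I J) (\<Phi>E J)))
     \<and>
     (admissible_coefficients \<Omega> Y a a1 ainf \<and>
      parametric_setting \<Omega> (U_LS \<Omega>) (ip_norm (inner_LS \<Omega>)) (D_LS \<Omega>) Y (form_LS \<Omega> a) cU CU \<and>
      uniform_frame_family (U_LS \<Omega>) (ip_norm (inner_LS \<Omega>)) I \<Phi>LS c\<Phi> C\<Phi>
      \<longrightarrow> uniformly_bounded_elliptic Y (form_LS \<Omega> a)
            (\<lambda>J. H_frame (D_LS \<Omega>) (I J) (\<Phi>LS J)))"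
proof (intro conjI impI)
  have \<Omega>: "open \<Omega>" using assms by (simp add: domain_def)
  show "uniformly_well_conditioned D I \<Phi>"
    if "hilbert_space_on U ip \<and>
      (\<forall>y\<in>Y. bilinear_form_on (L2_vec \<Omega>) (B y)) \<and>
      parametric_setting \<Omega> U (ip_norm ip) D Y B cU CU \<and>
      uniform_frame_family U (ip_norm ip) I \<Phi> c\<Phi> C\<Phi>"
    using that by (intro uniformly_well_conditioned_frames[of U ip]) (auto simp: parametric_setting_def)
  show "uniformly_bounded_elliptic Y (form_E \<Omega> a) (\<lambda>J. H_frame (weak_grad \<Omega>) (I J) (\<Phi>E J))"
    if *: "admissible_coefficients \<Omega> Y a a1 ainf \<and>
      parametric_setting \<Omega> (H10 \<Omega>) (ip_norm (H1_inner \<Omega>)) (weak_grad \<Omega>) Y (form_E \<Omega> a) cU CU \<and>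
      uniform_frame_family (H10 \<Omega>) (ip_norm (H1_inner \<Omega>)) I \<Phi>E c\<Phi> C\<Phi>"
  proof -
    \<comment> \<open>With H^1_0 known to be a subspace, one ellipticity constant serves all
      \<open>J\<close> and \<open>y\<close>.\<close>
    obtain c where "0 < c" "\<And>J y h. y \<in> Y \<Longrightarrow> h \<in> H_frame (weak_grad \<Omega>) (I J) (\<Phi>E J) \<Longrightarrow>
        c * (norm h)\<^sup>2 \<le> form_E \<Omega> a y h h"
      by (rule elliptic_on_H_frame[OF _ subspace_H10[OF \<Omega>]]) (use * in blast)+
    then show ?thesis
      using form_E_bounded[OF \<Omega>] * by (intro uniformly_bounded_ellipticI[of c]) auto
  qed
  show "uniformly_bounded_elliptic Y (form_LS \<Omega> a) (\<lambda>J. H_frame (D_LS \<Omega>) (I J) (\<Phi>LS J))"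
    if *: "admissible_coefficients \<Omega> Y a a1 ainf \<and>
      parametric_setting \<Omega> (U_LS \<Omega>) (ip_norm (inner_LS \<Omega>)) (D_LS \<Omega>) Y (form_LS \<Omega> a) cU CU \<and>
      uniform_frame_family (U_LS \<Omega>) (ip_norm (inner_LS \<Omega>)) I \<Phi>LS c\<Phi> C\<Phi>"
  proof -
    \<comment> \<open>The carrier is a product, so its linearity splits into that of H^1_0 and of
      H(div).\<close>
    have U: "subspace (U_LS \<Omega>)"
      unfolding U_LS_def by (intro subspace_Times subspace_H10[OF \<Omega>] subspace_Hdiv)
    obtain c where "0 < c" "\<And>J y h. y \<in> Y \<Longrightarrow> h \<in> H_frame (D_LS \<Omega>) (I J) (\<Phi>LS J) \<Longrightarrow>
        c * (norm h)\<^sup>2 \<le> form_LS \<Omega> a y h h"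
      by (rule elliptic_on_H_frame[OF _ U]) (use * in blast)+
    then show ?thesis
      using form_LS_bounded[OF \<Omega>] * by (intro uniformly_bounded_ellipticI[of c]) auto
  qed
qed

end
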